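(* (9 inspheres incidence theorem) Suppose a cubical polytope in $\mathbb{R}^3$ is split by $6$ planes into $27=3\times3\times3$ combinatorial cubes. Suppose the central cell and seven of the corner cells are circumscribed. Then the last corner cell is also circumscribed.
   Context: A cubical polytope is a convex polyhedron with quadrilateral faces combinatorially equivalent to the three-dimensional cube. It is circumscribed if it possesses an inscribed sphere (touching all its faces). The $6$ planes form three pairs; the planes of each pair separate a pair of opposite faces of the polytope, so that the $27$ cells are cubical polytopes arranged combinatorially as the unit cells of a $3\times3\times3$ cube. The corner cells are the eight cells containing the vertices of the big polytope; the central cell is the one having no points on its boundary. *)

theory Defs
  imports "HOL-Analysis.Analysis"
begin

text \<open>In the library the face relation \<open>face_of\<close> includes the empty face and the polytope itself,
  so the sets of faces below are the full face lattices.\<close>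

definition comb_equiv :: "(real^3) set \<Rightarrow> (real^3) set \<Rightarrow> bool" where
  "comb_equiv P Q \<longleftrightarrow>
     (\<exists>\<phi>. bij_betw \<phi> {F. F face_of P} {G. G face_of Q} \<and>
          (\<forall>F F'. F face_of P \<longrightarrow> F' face_of P \<longrightarrow> (F \<subseteq> F' \<longleftrightarrow> \<phi> F \<subseteq> \<phi> F')))"

text \<open>That the polytope is three-dimensional, with six quadrilateral facets, follows from the
  combinatorial equivalence.\<close>

definition cubical_polytope :: "(real^3) set \<Rightarrow> bool" where
  "cubical_polytope P \<longleftrightarrow> polytope P \<and> comb_equiv P (cbox 0 One)"

definition circumscribed :: "(real^3) set \<Rightarrow> bool" where
  "circumscribed P \<longleftrightarrow>
     (\<exists>c r. r > 0 \<and> sphere c r \<subseteq> P \<and> (\<forall>F. F facet_of P \<longrightarrow> sphere c r \<inter> F \<noteq> {}))"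

text \<open>The six cutting planes are \<open>{x. a i j \<bullet> x = b i j}\<close>, where \<open>i :: 3\<close> numbers the pairs and
  \<open>j < 2\<close> the two planes of a pair; values at \<open>j \<ge> 2\<close> are irrelevant. A cell is indexed by
  \<open>k\<close> with \<open>k i < 3\<close>: it consists of the points of \<open>P\<close> that lie, for each \<open>i\<close>, beyond exactly
  the first \<open>k i\<close> planes of the \<open>i\<close>-th pair.\<close>

definition cell_indices :: "(3 \<Rightarrow> nat) set" where
  "cell_indices = {k. \<forall>i. k i < 3}"

definition cell ::
  "(real^3) set \<Rightarrow> (3 \<Rightarrow> nat \<Rightarrow> real^3) \<Rightarrow> (3 \<Rightarrow> nat \<Rightarrow> real) \<Rightarrow> (3 \<Rightarrow> nat) \<Rightarrow> (real^3) set" where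
  "cell P a b k =
     {x \<in> P. \<forall>i. \<forall>j<2. if j < k i then a i j \<bullet> x \<ge> b i j else a i j \<bullet> x \<le> b i j}"

definition cells ::
  "(real^3) set \<Rightarrow> (3 \<Rightarrow> nat \<Rightarrow> real^3) \<Rightarrow> (3 \<Rightarrow> nat \<Rightarrow> real) \<Rightarrow> (real^3) set set" where
  "cells P a b = cell P a b ` cell_indices"

text \<open>The cells of the cube \<open>[0,3]\<^sup>3\<close>.\<close>

definition unit_cell :: "(3 \<Rightarrow> nat) \<Rightarrow> (real^3) set" where
  "unit_cell k = cbox (\<chi> i. real (k i)) (\<chi> i. real (k i) + 1)"

text \<open>\<open>C\<close> is combinatorially arranged like the unit cells: the complexes formed by all faces of all
  cells are isomorphic, and the isomorphism takes each cell to the unit cell with the same index.\<close>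

definition arranged_as_unit_cells :: "((3 \<Rightarrow> nat) \<Rightarrow> (real^3) set) \<Rightarrow> bool" where
  "arranged_as_unit_cells C \<longleftrightarrow>
     (let X = (\<Union>k\<in>cell_indices. {F. F face_of C k});
          Y = (\<Union>k\<in>cell_indices. {G. G face_of unit_cell k})
      in \<exists>\<phi>. bij_betw \<phi> X Y \<and> (\<forall>F\<in>X. \<forall>F'\<in>X. F \<subseteq> F' \<longleftrightarrow> \<phi> F \<subseteq> \<phi> F') \<and>
             (\<forall>k\<in>cell_indices. \<phi> (C k) = unit_cell k))"

text \<open>Two facets of a cubical polytope are opposite iff they are disjoint. The planes of the
  \<open>i\<close>-th pair are oriented so that \<open>F i\<close> lies below and \<open>G i\<close> above them. Weak separation
  suffices: with all cells cubical, the planes cannot meet the faces they separate.\<close>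

definition split_3x3x3 ::
  "(real^3) set \<Rightarrow> (3 \<Rightarrow> nat \<Rightarrow> real^3) \<Rightarrow> (3 \<Rightarrow> nat \<Rightarrow> real) \<Rightarrow> bool" where
  "split_3x3x3 P a b \<longleftrightarrow>
     (\<forall>i. \<forall>j<2. a i j \<noteq> 0) \<and>
     (\<exists>F G. {S. S facet_of P} = range F \<union> range G \<and>
        (\<forall>i. F i \<inter> G i = {} \<and>
             (\<forall>j<2. F i \<subseteq> {x. a i j \<bullet> x \<le> b i j} \<and> G i \<subseteq> {x. a i j \<bullet> x \<ge> b i j}))) \<and>
     P = \<Union>(cells P a b) \<and>
     (\<forall>C\<in>cells P a b. cubical_polytope C) \<and>
     arranged_as_unit_cells (cell P a b)"

definition corner_cells :: "(real^3) set \<Rightarrow> (real^3) set set \<Rightarrow> (real^3) set set" where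
  "corner_cells P \<C> = {C \<in> \<C>. \<exists>v. v extreme_point_of P \<and> v \<in> C}"

text \<open>The boundary here is that of the big polytope.\<close>

definition central_cell :: "(real^3) set \<Rightarrow> (real^3) set set \<Rightarrow> (real^3) set \<Rightarrow> bool" where
  "central_cell P \<C> C \<longleftrightarrow> C \<in> \<C> \<and> C \<inter> frontier P = {}"

end

theory Submission imports Defs begin

text \<open>Represent a sphere by its centre and radius \<open>(c, r) \<in> \<real>\<^sup>3 \<times> \<real>\<close>. Tangency to the plane
  \<open>n \<bullet> x = h\<close> with unit normal \<open>n\<close>, from the side to which \<open>n\<close> points, is the linear condition
  \<open>n \<bullet> c - r = h\<close>. A corner cell is bounded by three pairs of planes, each consisting of a facet
  plane of the big polytope and the cutting plane next to it, and each pair is shared by four corner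
  cells. A pair cuts out a two-dimensional affine subspace of \<open>\<real>\<^sup>4\<close>, and a corner cell is
  circumscribed iff its three subspaces have a common point. So the inspheres of the seven corner
  cells are vertices of a cube in \<open>\<real>\<^sup>4\<close> whose faces are planar. Such a cube lies in a
  three-dimensional subspace, in which the three planes through the last vertex meet. Degenerate
  positions are excluded because the six normals of a bounded cell admit no common solution of
  \<open>n \<bullet> v = r\<close> other than \<open>v = 0\<close>, \<open>r = 0\<close>.\<close>

subsection \<open>Cubes with planar faces\<close>

lemma subspace_eq_span_pair:
  fixes D :: "'a::euclidean_space set"
  assumes "subspace D" "dim D = 2" "u \<in> D" "v \<in> D" "v \<noteq> 0" "\<And>c. u \<noteq> c *\<^sub>R v"
  shows "D = span {u, v}"
proof -
  have "u \<notin> span {v}" using assms(6) by (auto simp: span_singleton)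
  then have "dim {u, v} = 2" using assms(5) by (simp add: dim_insert)
  then show ?thesis
    using subspace_dim_equal[of "span {u, v}" D] assms span_minimal[of "{u, v}" D]
    by (auto simp: dim_span)
qed

text \<open>The common kernel is the orthogonal complement of the plane spanned by \<open>p\<close>
  and \<open>q\<close>. Applied in \<real>^4, it gives dimension 2 for a pair of tangency
  conditions.\<close>

lemma dim_two_hyperplanes:
  fixes p q :: "'a::euclidean_space"
  assumes "q \<noteq> 0" "\<And>c. p \<noteq> c *\<^sub>R q"
  shows "dim {x. p \<bullet> x = 0 \<and> q \<bullet> x = 0} = DIM('a) - 2"
proof -
  have "p \<notin> span {q}" using assms(2) by (auto simp: span_singleton)
  then have "dim (span {p, q}) = 2" using assms(1) by (simp add: dim_insert)
  moreover have "{y \<in> UNIV. \<forall>x\<in>span {p, q}. orthogonal x y} = {x. p \<bullet> x = 0 \<and> q \<bullet> x = 0}"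
  proof (intro equalityI subsetI)
    fix y assume y: "y \<in> {y \<in> UNIV. \<forall>x\<in>span {p, q}. orthogonal x y}"
    have "p \<in> span {p, q}" "q \<in> span {p, q}" by (simp_all add: span_base)
    then show "y \<in> {x. p \<bullet> x = 0 \<and> q \<bullet> x = 0}" using y by (auto simp: orthogonal_def)
  next
    fix y assume "y \<in> {x. p \<bullet> x = 0 \<and> q \<bullet> x = 0}"
    then have "orthogonal y x" if "x \<in> span {p, q}" for x
      using that by (intro orthogonal_to_span[of x "{p, q}"]) (auto simp: orthogonal_def inner_commute)
    then show "y \<in> {y \<in> UNIV. \<forall>x\<in>span {p, q}. orthogonal x y}"
      by (simp add: orthogonal_commute)
  qed
  ultimately show ?thesis
    using dim_subspace_orthogonal_to_vectors[of "span {p, q}" UNIV] by simp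
qed

text \<open>The points \<open>0, u1, u2, u3, u12, u13, u23\<close> are vertices of a combinatorial cube with planar
  faces, the last vertex being sought; \<open>D1\<close> is the direction of the face \<open>0, u2, u3, u23\<close> and \<open>E1\<close>
  that of the opposite face. Planarity forces all points and directions into the span of
  \<open>u1, u2, u3\<close>, where three planes without common direction meet.\<close>

lemma eighth_cube_vertex_aux:
  fixes D1 D2 D3 E1 E2 E3 :: "'a::euclidean_space set"
  assumes sub: "subspace D1" "subspace D2" "subspace D3" "subspace E1" "subspace E2" "subspace E3"
    and dims: "dim D1 = 2" "dim D2 = 2" "dim D3 = 2" "dim E1 = 2" "dim E2 = 2" "dim E3 = 2"
    and triv: "D1 \<inter> D2 \<inter> D3 \<subseteq> {0}" "E1 \<inter> D2 \<inter> D3 \<subseteq> {0}" "D1 \<inter> E2 \<inter> D3 \<subseteq> {0}"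
      "D1 \<inter> D2 \<inter> E3 \<subseteq> {0}" "E1 \<inter> E2 \<inter> E3 \<subseteq> {0}"
    and u1: "u1 \<in> D2" "u1 \<in> D3" and u2: "u2 \<in> D1" "u2 \<in> D3" and u3: "u3 \<in> D1" "u3 \<in> D2"
    and u12: "u12 \<in> D3" "u12 - u1 \<in> E1" "u12 - u2 \<in> E2"
    and u13: "u13 \<in> D2" "u13 - u1 \<in> E1" "u13 - u3 \<in> E3"
    and u23: "u23 \<in> D1" "u23 - u2 \<in> E2" "u23 - u3 \<in> E3"
    and ne: "u1 \<noteq> 0" "u2 \<noteq> 0" "u3 \<noteq> 0" "u12 \<noteq> u1" "u12 \<noteq> u2" "u13 \<noteq> u1" "u13 \<noteq> u3"
      "u23 \<noteq> u2" "u23 \<noteq> u3"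
  shows "\<exists>x. x - u1 \<in> E1 \<and> x - u2 \<in> E2 \<and> x - u3 \<in> E3"
proof -
  \<comment> \<open>If \<open>v\<close> and \<open>w\<close> were parallel, they would lie in all
    three spaces at once, against the trivial intersection.\<close>
  have pair: "D = span {v, w}"
    if "subspace D" "subspace D'" "dim D = 2" "v \<in> D" "v \<in> D'" "w \<in> D" "w \<in> D''" "v \<noteq> 0" "w \<noteq> 0"
      "D \<inter> D' \<inter> D'' \<subseteq> {0}" "subspace D''" for D D' D'' and v w :: 'a
  proof (rule subspace_eq_span_pair)
    show "v \<noteq> c *\<^sub>R w" for c
      using that subspace_scale[of D'' w c] by auto
  qed (use that in auto)
  define W where "W = span {u1, u2, u3}"
  have subW: "subspace W" by (simp add: W_def)
  have dimW: "dim W \<le> 3"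
    unfolding W_def dim_span by (rule order.trans[OF dim_le_card']) (auto simp: card_insert_if)
  have D: "D1 \<subseteq> W" "D2 \<subseteq> W" "D3 \<subseteq> W"
  proof -
    have "D1 = span {u2, u3}" by (rule pair[of _ D3 _ _ D2]) (use assms in auto)
    moreover have "D2 = span {u1, u3}" by (rule pair[of _ D3 _ _ D1]) (use assms in auto)
    moreover have "D3 = span {u1, u2}" by (rule pair[of _ D2 _ _ D1]) (use assms in auto)
    ultimately show "D1 \<subseteq> W" "D2 \<subseteq> W" "D3 \<subseteq> W"
      unfolding W_def by (simp_all add: span_mono)
  qed
  have uW: "u1 \<in> W" "u2 \<in> W" "u3 \<in> W" "u12 \<in> W" "u13 \<in> W" "u23 \<in> W"
    using D u1 u2 u3 u12 u13 u23 by auto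
  have E: "E1 \<subseteq> W" "E2 \<subseteq> W" "E3 \<subseteq> W"
  proof -
    have "E1 = span {u12 - u1, u13 - u1}"
      by (rule pair[of _ D3 _ _ D2]) (use assms in \<open>auto intro: subspace_diff\<close>)
    moreover have "E2 = span {u12 - u2, u23 - u2}"
      by (rule pair[of _ D3 _ _ D1]) (use assms in \<open>auto intro: subspace_diff\<close>)
    moreover have "E3 = span {u13 - u3, u23 - u3}"
      by (rule pair[of _ D2 _ _ D1]) (use assms in \<open>auto intro: subspace_diff\<close>)
    ultimately show "E1 \<subseteq> W" "E2 \<subseteq> W" "E3 \<subseteq> W"
      using uW by (simp_all add: span_minimal subspace_diff subW)
  qed
  \<comment> \<open>Two planes in a space of dimension at most 3 share a line; \<open>d\<close> will
    be a direction of it.\<close>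
  have "dim {x + y |x y. x \<in> E1 \<and> y \<in> E2} \<le> dim W"
    using E by (intro dim_subset) (auto intro: subspace_add[OF subW])
  then have "dim (E1 \<inter> E2) \<ge> 1"
    using dim_sums_Int[OF sub(4,5)] dims dimW by linarith
  then have "\<not> E1 \<inter> E2 \<subseteq> {0}"
    using dim_eq_0[of "E1 \<inter> E2"] by linarith
  then obtain d where d: "d \<in> E1" "d \<in> E2" "d \<noteq> 0"
    by auto
  \<comment> \<open>The three planes meet only in 0, so \<open>d\<close> is transversal to
    \<open>E3\<close> and together they fill \<open>W\<close>.\<close>
  then have "d \<notin> span E3"
    using triv sub(6) by (auto simp: span_eq_iff[THEN iffD2])
  then have "dim (span (insert d E3)) = 3"
    using dims by (simp add: dim_insert)
  moreover have "span (insert d E3) \<subseteq> W"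
    using d E subW by (intro span_minimal) auto
  ultimately have "span (insert d E3) = W"
    using subspace_dim_equal[of "span (insert d E3)" W] subW dimW by simp
  \<comment> \<open>Moving \<open>u12\<close> along \<open>d\<close> keeps it on the faces with
    directions \<open>E1\<close> and \<open>E2\<close>; transversality yields the amount
    \<open>t\<close> that brings it onto the third face.\<close>
  moreover have "u12 - u13 \<in> W" using uW subW by (auto intro: subspace_diff)
  ultimately obtain t where "u12 - u13 - t *\<^sub>R d \<in> span E3"
    using span_breakdown_eq by blast
  then have t: "u12 - u13 - t *\<^sub>R d \<in> E3" using sub(6) by (simp add: span_eq_iff[THEN iffD2])
  have "u12 - u1 - t *\<^sub>R d \<in> E1" "u12 - u2 - t *\<^sub>R d \<in> E2"
    using u12 d sub by (auto intro: subspace_diff subspace_scale)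
  moreover have "(u12 - u13 - t *\<^sub>R d) + (u13 - u3) \<in> E3"
    by (rule subspace_add[OF sub(6) t u13(3)])
  ultimately show ?thesis
    by (intro exI[of _ "u12 - t *\<^sub>R d"]) (simp add: algebra_simps)
qed

text \<open>Reflecting the cube so that the missing vertex becomes the all-\<open>True\<close> one,
  and translating its antipode to 0, reduces this to the preceding lemma. By \<open>flat\<close>,
  each \<open>A i t\<close> is empty or a translate of \<open>D i t\<close>.\<close>

lemma eighth_cube_vertex:
  fixes D :: "3 \<Rightarrow> bool \<Rightarrow> 'a::euclidean_space set" and X :: "(3 \<Rightarrow> bool) \<Rightarrow> 'a"
  assumes sub: "\<And>i t. subspace (D i t)" and dims: "\<And>i t. dim (D i t) = 2"
    and flat: "\<And>i t x y. x \<in> A i t \<Longrightarrow> y \<in> A i t \<longleftrightarrow> y - x \<in> D i t"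
    and triv: "\<And>s. (\<Inter>i. D i (s i)) \<subseteq> {0}"
    and X: "\<And>s i. s \<noteq> s0 \<Longrightarrow> X s \<in> A i (s i)"
    and inj: "\<And>s s'. s \<noteq> s0 \<Longrightarrow> s' \<noteq> s0 \<Longrightarrow> s \<noteq> s' \<Longrightarrow> X s \<noteq> X s'"
  shows "\<exists>x. \<forall>i. x \<in> A i (s0 i)"
proof -
  \<comment> \<open>\<open>True\<close> keeps a coordinate of \<open>s0\<close>,
    \<open>False\<close> flips it.\<close>
  define S :: "bool \<Rightarrow> bool \<Rightarrow> bool \<Rightarrow> 3 \<Rightarrow> bool" where
    "S p q r = (\<lambda>i. if i = 1 then s0 1 = p else if i = 2 then s0 2 = q else s0 3 = r)" for p q r
  have S_app: "S p q r 1 = (s0 1 = p)" "S p q r 2 = (s0 2 = q)" "S p q r 3 = (s0 3 = r)" for p q r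
    by (auto simp: S_def)
  have S_ne: "S p q r \<noteq> s0 \<longleftrightarrow> \<not> (p \<and> q \<and> r)" for p q r
    by (auto simp: fun_eq_iff forall_3 S_app)
  have S_inj: "S p q r \<noteq> S p' q' r' \<longleftrightarrow> \<not> (p = p' \<and> q = q' \<and> r = r')" for p q r p' q' r'
    by (auto simp: fun_eq_iff forall_3 S_app)
  define Y where "Y p q r = X (S p q r)" for p q r
  have Y: "Y p q r \<in> A 1 (s0 1 = p)" "Y p q r \<in> A 2 (s0 2 = q)" "Y p q r \<in> A 3 (s0 3 = r)"
    if "\<not> (p \<and> q \<and> r)" for p q r
    using X[of "S p q r" 1] X[of "S p q r" 2] X[of "S p q r" 3] that
    by (simp_all only: S_ne S_app Y_def simp_thms)
  have diff: "Y p q r - Y p q' r' \<in> D 1 (s0 1 = p)"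
    if "\<not> (p \<and> q \<and> r)" "\<not> (p \<and> q' \<and> r')" for p q r q' r'
    using Y(1) flat that by blast
  have diff2: "Y p q r - Y p' q r' \<in> D 2 (s0 2 = q)"
    if "\<not> (p \<and> q \<and> r)" "\<not> (p' \<and> q \<and> r')" for p q r p' r'
    using Y(2) flat that by blast
  have diff3: "Y p q r - Y p' q' r \<in> D 3 (s0 3 = r)"
    if "\<not> (p \<and> q \<and> r)" "\<not> (p' \<and> q' \<and> r)" for p q r p' q'
    using Y(3) flat that by blast
  have Yinj: "Y p q r = Y p' q' r' \<longleftrightarrow> p = p' \<and> q = q' \<and> r = r'"
    if "\<not> (p \<and> q \<and> r)" "\<not> (p' \<and> q' \<and> r')" for p q r p' q' r'
    using inj[of "S p q r" "S p' q' r'"] that S_ne S_inj unfolding Y_def by metis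
  have tr: "D 1 (s0 1 = p) \<inter> D 2 (s0 2 = q) \<inter> D 3 (s0 3 = r) \<subseteq> {0}" for p q r
    using triv[of "S p q r"] unfolding INT_extend_simps
    by (auto simp: subset_iff forall_3 S_app)
  define z where "z = Y False False False"
  have "\<exists>x. x - (Y True False False - z) \<in> D 1 (s0 1 = True) \<and>
        x - (Y False True False - z) \<in> D 2 (s0 2 = True) \<and>
        x - (Y False False True - z) \<in> D 3 (s0 3 = True)"
  proof (rule eighth_cube_vertex_aux[where ?u12.0 = "Y True True False - z"
        and ?u13.0 = "Y True False True - z" and ?u23.0 = "Y False True True - z"
        and ?D1.0 = "D 1 (s0 1 = False)" and ?D2.0 = "D 2 (s0 2 = False)"
        and ?D3.0 = "D 3 (s0 3 = False)"])
  qed (use sub dims in \<open>auto simp only: z_def diff_diff_eq2 diff_add_cancel Yinj right_minus_eq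
        intro!: diff diff2 diff3 tr\<close>, (simp add: Yinj)+)
  then obtain x where x: "x - (Y True False False - z) \<in> D 1 (s0 1)"
        "x - (Y False True False - z) \<in> D 2 (s0 2)" "x - (Y False False True - z) \<in> D 3 (s0 3)"
    by auto
  have "x + z \<in> A 1 (s0 1)" "x + z \<in> A 2 (s0 2)" "x + z \<in> A 3 (s0 3)"
    using x flat[OF Y(1)[of True False False]] flat[OF Y(2)[of False True False]]
      flat[OF Y(3)[of False False True]] by (auto simp: algebra_simps)
  then show ?thesis by (auto simp: forall_3)
qed

subsection \<open>Facets of polytopes and inscribed spheres\<close>

text \<open>Facets expressed by inclusion of faces alone, so that a lattice isomorphism, which says
  nothing about dimension, can carry them over.\<close>

definition maximal_face :: "'a::euclidean_space set \<Rightarrow> 'a set \<Rightarrow> bool" where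
  "maximal_face S F \<longleftrightarrow> F face_of S \<and> F \<noteq> S \<and> (\<forall>G. G face_of S \<longrightarrow> F \<subseteq> G \<longrightarrow> G = F \<or> G = S)"

text \<open>Dimension grows strictly from a face to a larger one, which leaves no room between a
  facet and \<open>S\<close>.\<close>

lemma facet_imp_maximal_face:
  assumes "convex S" "F facet_of S"
  shows "maximal_face S F"
  unfolding maximal_face_def
proof (intro conjI allI impI)
  show "F face_of S" "F \<noteq> S" using assms by (auto simp: facet_of_def)
  fix G assume G: "G face_of S" "F \<subseteq> G"
  show "G = F \<or> G = S"
  proof (rule ccontr)
    assume *: "\<not> (G = F \<or> G = S)"
    have "F face_of G"
      using \<open>F face_of S\<close> G by (meson face_of_imp_subset face_of_subset)
    then have "aff_dim F < aff_dim G"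
      using * face_of_aff_dim_lt[of G F] face_of_imp_convex[OF G(1)] by blast
    moreover have "aff_dim G < aff_dim S" using * G(1) assms(1) face_of_aff_dim_lt by blast
    ultimately show False using assms(2) by (simp add: facet_of_def)
  qed
qed

text \<open>A nonempty proper face lies in some facet, which maximality identifies with it. A single
  point shows why \<open>F\<close> must be nonempty: its only proper face is empty.\<close>

lemma maximal_face_imp_facet:
  assumes "polyhedron S" "maximal_face S F" "F \<noteq> {}"
  shows "F facet_of S"
proof -
  obtain G where "G facet_of S" "F \<subseteq> G"
    using assms face_of_polyhedron_subset_facet unfolding maximal_face_def by metis
  then show ?thesis
    using assms(2) unfolding maximal_face_def by (metis facet_of_def facet_of_irrefl)
qed

lemma interior_halfspace_strict:
  fixes n :: "'a::euclidean_space"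
  assumes "C \<subseteq> {x. h \<le> n \<bullet> x}" "n \<noteq> 0" "x \<in> interior C"
  shows "h < n \<bullet> x"
  using interior_mono[OF assms(1)] assms(2,3) by (auto simp: interior_halfspace_ge)

lemma hyperplane_section_face:
  fixes n :: "'a::euclidean_space"
  assumes "convex C" "interior C \<noteq> {}" "C \<subseteq> {x. h \<le> n \<bullet> x}" "n \<noteq> 0"
  shows "C \<inter> {x. n \<bullet> x = h} face_of C" "C \<inter> {x. n \<bullet> x = h} \<noteq> C"
proof -
  show "C \<inter> {x. n \<bullet> x = h} face_of C"
    using assms by (intro face_of_Int_supporting_hyperplane_ge) auto
  obtain x where "x \<in> interior C" using assms(2) by auto
  then have "x \<in> C" "n \<bullet> x \<noteq> h"
    using interior_halfspace_strict[OF assms(3,4), of x] interior_subset by auto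
  then show "C \<inter> {x. n \<bullet> x = h} \<noteq> C" by blast
qed

text \<open>The section is a face containing \<open>F\<close>, and it is proper because
  \<open>C\<close> has interior points; maximality leaves only \<open>F\<close>.\<close>

lemma maximal_face_eq_hyperplane_section:
  fixes n :: "'a::euclidean_space"
  assumes "convex C" "interior C \<noteq> {}" "C \<subseteq> {x. h \<le> n \<bullet> x}" "n \<noteq> 0"
    and "maximal_face C F" "F \<subseteq> {x. n \<bullet> x = h}"
  shows "F = C \<inter> {x. n \<bullet> x = h}"
  using hyperplane_section_face[OF assms(1-4)] assms(5,6)
  unfolding maximal_face_def by (metis face_of_imp_subset le_inf_iff)

text \<open>The segment from \<open>x\<close> to \<open>y\<close> leaves \<open>C\<close> at a point
  \<open>z\<close> of some facet; an affine function positive at \<open>x\<close> and zero at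
  \<open>z\<close> is negative at \<open>y\<close>. The conclusion covers every supporting equation
  of the facet, so that each use can insert its own normalisation.\<close>

lemma separating_facet:
  assumes "polyhedron C" "x \<in> interior C" "y \<notin> C"
  obtains F where "F facet_of C"
    "\<And>n h. n \<noteq> 0 \<Longrightarrow> C \<subseteq> {x. h \<le> n \<bullet> x} \<Longrightarrow> F \<subseteq> {x. n \<bullet> x = h} \<Longrightarrow> n \<bullet> y < h"
proof -
  have "closed_segment x y \<inter> frontier C \<noteq> {}"
    using assms interior_subset by (intro connected_Int_frontier) auto
  then obtain z where z: "z \<in> closed_segment x y" "z \<in> frontier C" by auto
  then have "z \<in> C - rel_interior C"
    using assms polyhedron_imp_closed[of C] rel_interior_nonempty_interior[of C]
    by (auto simp: frontier_def)
  then obtain F where F: "F facet_of C" "z \<in> F"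
    using rel_boundary_of_polyhedron[OF assms(1)] by auto
  show thesis
  proof (rule that[OF F(1)])
    fix n :: 'a and h assume n: "n \<noteq> 0" "C \<subseteq> {x. h \<le> n \<bullet> x}" "F \<subseteq> {x. n \<bullet> x = h}"
    obtain t where t: "0 \<le> t" "t \<le> 1" "z = (1 - t) *\<^sub>R x + t *\<^sub>R y"
      using z(1) by (auto simp: closed_segment_def)
    have "t \<noteq> 1" using t(3) F facet_of_imp_subset assms(3) by fastforce
    moreover have "h < n \<bullet> x" by (rule interior_halfspace_strict[OF n(2,1) assms(2)])
    ultimately have "0 < (1 - t) * (n \<bullet> x - h)" using t(2) by simp
    also have "\<dots> = t * (h - n \<bullet> y)"
      using n(3) F(2) t(3) by (auto simp: inner_add_right algebra_simps)
    finally show "n \<bullet> y < h" using t(1) by (simp add: zero_less_mult_iff)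
  qed
qed

lemma facet_unit_normal:
  assumes "polyhedron S" "F facet_of S"
  obtains n h where "norm n = 1" "S \<subseteq> {x. h \<le> n \<bullet> x}" "F = S \<inter> {x. n \<bullet> x = h}"
proof -
  obtain a b where ab: "a \<noteq> 0" "S \<subseteq> {x. a \<bullet> x \<le> b}" "F = S \<inter> {x. a \<bullet> x = b}"
    using facet_of_polyhedron[OF assms] by blast
  show thesis
  proof (rule that[of "- (a /\<^sub>R norm a)" "- b / norm a"])
    show "norm (- (a /\<^sub>R norm a)) = 1" using ab by simp
    show "S \<subseteq> {x. - b / norm a \<le> - (a /\<^sub>R norm a) \<bullet> x}"
      using ab by (auto simp: divide_simps)
    show "F = S \<inter> {x. - (a /\<^sub>R norm a) \<bullet> x = - b / norm a}"
      using ab by (auto simp: divide_simps)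
  qed
qed

lemma bounded_ray_zero:
  fixes v :: "'a::real_normed_vector"
  assumes "bounded S" "\<And>t. t \<ge> 0 \<Longrightarrow> x + t *\<^sub>R v \<in> S"
  shows "v = 0"
proof (rule ccontr)
  assume "v \<noteq> 0"
  obtain B where B: "\<And>y. y \<in> S \<Longrightarrow> norm y \<le> B"
    using assms(1) by (auto simp: bounded_iff)
  have "B \<ge> 0" by (rule order.trans[OF norm_ge_zero B[OF assms(2)[of 0]]]) simp
  \<comment> \<open>Long enough for the ray to leave the ball of radius \<open>B\<close> about 0
    even when it starts at \<open>x\<close>.\<close>
  define t where "t = (B + norm x + 1) / norm v"
  have "t \<ge> 0" using \<open>B \<ge> 0\<close> by (simp add: t_def)
  have "norm (t *\<^sub>R v) = B + norm x + 1"
    using \<open>v \<noteq> 0\<close> \<open>B \<ge> 0\<close> by (simp add: t_def)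
  moreover have "norm (t *\<^sub>R v) \<le> norm (x + t *\<^sub>R v) + norm x"
    using norm_triangle_ineq4[of "x + t *\<^sub>R v" x] by simp
  ultimately show False using B[OF assms(2)[OF \<open>t \<ge> 0\<close>]] by simp
qed

section \<open>Polytopes described by inward unit facet normals\<close>

locale facet_system =
  fixes C :: "(real^3) set" and n :: "'i \<Rightarrow> real^3" and h :: "'i \<Rightarrow> real"
  assumes polytope: "polytope C" and nonempty_interior: "interior C \<noteq> {}"
    and norm_n: "\<And>i. norm (n i) = 1"
    and halfspace: "\<And>i. C \<subseteq> {x. h i \<le> n i \<bullet> x}"
    and facets: "{F. F facet_of C} = range (\<lambda>i. C \<inter> {x. n i \<bullet> x = h i})"
begin

lemma n_nonzero: "n i \<noteq> 0"
  using norm_n[of i] by auto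

text \<open>A point outside would violate the inequality of the facet through which a segment from
  an interior point leaves \<open>C\<close>.\<close>

lemma mem_if_halfspaces:
  assumes "\<And>i. h i \<le> n i \<bullet> y"
  shows "y \<in> C"
proof (rule ccontr)
  assume "y \<notin> C"
  moreover obtain x where "x \<in> interior C" using nonempty_interior by auto
  ultimately obtain F where F: "F facet_of C"
    "\<And>n h. n \<noteq> 0 \<Longrightarrow> C \<subseteq> {x. h \<le> n \<bullet> x} \<Longrightarrow> F \<subseteq> {x. n \<bullet> x = h} \<Longrightarrow> n \<bullet> y < h"
    using separating_facet polytope_imp_polyhedron[OF polytope] by blast
  then obtain i where "F = C \<inter> {x. n i \<bullet> x = h i}" using facets by blast
  then have "n i \<bullet> y < h i" using F(2)[OF n_nonzero halfspace] by auto
  then show False using assms[of i] by simp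
qed

text \<open>Such a \<open>v\<close> is a recession direction: \<open>C\<close> would contain a whole
  ray, but it is bounded.\<close>

lemma recession_zero:
  assumes "\<And>i. 0 \<le> n i \<bullet> v"
  shows "v = 0"
proof -
  obtain x where "x \<in> C" using nonempty_interior interior_subset by auto
  show ?thesis
  proof (rule bounded_ray_zero)
    show "bounded C" by (rule polytope_imp_bounded[OF polytope])
    show "x + t *\<^sub>R v \<in> C" if "t \<ge> 0" for t
    proof (rule mem_if_halfspaces)
      fix i
      have "h i \<le> n i \<bullet> x" "0 \<le> t * (n i \<bullet> v)" using \<open>x \<in> C\<close> halfspace assms that by auto
      then show "h i \<le> n i \<bullet> (x + t *\<^sub>R v)" by (simp add: inner_add_right)
    qed
  qed
qed

text \<open>Depending on the sign of \<open>r\<close>, either \<open>v\<close> or \<open>- v\<close>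
  is a recession direction. Hence the tangency conditions of all facets have at most one solution
  \<open>(c, r)\<close>.\<close>

lemma no_common_direction:
  assumes "\<And>i. n i \<bullet> v = r"
  shows "v = 0 \<and> r = 0"
proof -
  have "v = 0"
  proof (cases "r \<ge> 0")
    case True
    then show ?thesis by (intro recession_zero) (simp add: assms)
  next
    case False
    then have "- v = 0" by (intro recession_zero) (simp add: assms)
    then show ?thesis by simp
  qed
  then show ?thesis using assms by simp
qed

lemma circumscribedD:
  assumes "circumscribed C"
  obtains c r where "c \<in> C" "r > 0" "\<And>i. n i \<bullet> c - h i = r"
proof -
  obtain c r where r: "r > 0" and sph: "sphere c r \<subseteq> C"
    and tangent: "\<And>F. F facet_of C \<Longrightarrow> sphere c r \<inter> F \<noteq> {}"
    using assms by (auto simp: circumscribed_def)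
  have *: "n i \<bullet> c - h i = r" for i
  proof (rule antisym)
    \<comment> \<open>The point of the sphere furthest in direction \<open>- n i\<close> lies in
      \<open>C\<close>, so the radius is at most the distance to the plane.\<close>
    have "c - r *\<^sub>R n i \<in> sphere c r" using norm_n r by (simp add: dist_norm)
    then have "h i \<le> n i \<bullet> (c - r *\<^sub>R n i)" using sph halfspace by blast
    then show "r \<le> n i \<bullet> c - h i"
      using norm_n[of i] by (simp add: inner_diff_right norm_eq_1)
    \<comment> \<open>A point of contact bounds the distance by the radius.\<close>
    have "(C \<inter> {x. n i \<bullet> x = h i}) facet_of C" using facets by blast
    then obtain y where y: "y \<in> sphere c r" "n i \<bullet> y = h i" using tangent by blast
    have "n i \<bullet> (c - y) \<le> norm (n i) * norm (c - y)" by (rule norm_cauchy_schwarz)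
    then show "n i \<bullet> c - h i \<le> r" using y norm_n by (simp add: inner_diff_right dist_norm)
  qed
  have "c \<in> C" by (rule mem_if_halfspaces) (use * r in \<open>smt (verit)\<close>)
  then show thesis using that r * by blast
qed

text \<open>The sign of \<open>r\<close> has to be derived, because the last sphere arises from
  linear equations only.\<close>

lemma circumscribedI:
  assumes eq: "\<And>i. n i \<bullet> c - h i = r"
  shows "circumscribed C"
  unfolding circumscribed_def
proof (intro exI conjI allI impI)
  show "r > 0"
  proof (rule ccontr)
    assume "\<not> r > 0"
    obtain x where x: "x \<in> interior C" using nonempty_interior by auto
    \<comment> \<open>If \<open>r \<le> 0\<close>, the vector from \<open>c\<close> to an interior
      point makes a positive product with every normal, so it is a recession direction.\<close>
    have pos: "n i \<bullet> (x - c) > 0" for i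
      using interior_halfspace_strict[OF halfspace n_nonzero x, of i] eq[of i] \<open>\<not> r > 0\<close>
      by (simp add: inner_diff_right)
    then have "x - c = 0" by (intro recession_zero) (simp add: less_imp_le)
    then show False using pos by simp
  qed
  show sph: "sphere c r \<subseteq> C"
  proof
    fix y assume y: "y \<in> sphere c r"
    show "y \<in> C"
    proof (rule mem_if_halfspaces)
      fix i
      have "n i \<bullet> (c - y) \<le> norm (n i) * norm (c - y)" by (rule norm_cauchy_schwarz)
      then show "h i \<le> n i \<bullet> y"
        using y norm_n eq[of i] by (simp add: inner_diff_right dist_norm)
    qed
  qed
  fix F assume "F facet_of C"
  then obtain i where i: "F = C \<inter> {x. n i \<bullet> x = h i}" using facets by blast
  have "c - r *\<^sub>R n i \<in> sphere c r" using norm_n \<open>r > 0\<close> by (simp add: dist_norm)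
  moreover have "n i \<bullet> (c - r *\<^sub>R n i) = h i"
    using norm_n[of i] eq[of i] by (simp add: inner_diff_right norm_eq_1)
  ultimately show "sphere c r \<inter> F \<noteq> {}" using i sph by blast
qed

end

section \<open>Facets through a vertex\<close>

text \<open>With fewer than three facets through \<open>v\<close>, some \<open>u \<noteq> 0\<close>
  is orthogonal to all their normals. A short step along \<open>u\<close> or \<open>- u\<close>
  stays in \<open>P\<close>, so \<open>v\<close> is the midpoint of a segment in
  \<open>P\<close>.\<close>

lemma extreme_point_three_facets:
  fixes P :: "'a::euclidean_space set"
  assumes P: "polytope P" "interior P \<noteq> {}" "v extreme_point_of P" and dim: "DIM('a) = 3"
  shows "3 \<le> card {F. F facet_of P \<and> v \<in> F}"
proof (rule ccontr)
  assume less: "\<not> ?thesis"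
  note ph = polytope_imp_polyhedron[OF P(1)]
  have fin: "finite {F. F facet_of P}" by (rule finite_polytope_facets[OF P(1)])
  have "\<exists>n h. norm n = 1 \<and> P \<subseteq> {x. h \<le> n \<bullet> x} \<and> F = P \<inter> {x. n \<bullet> x = h}"
    if "F facet_of P" for F
    using facet_unit_normal[OF ph that] by blast
  then have "\<forall>F. \<exists>n h. F facet_of P \<longrightarrow>
      norm n = 1 \<and> P \<subseteq> {x. h \<le> n \<bullet> x} \<and> F = P \<inter> {x. n \<bullet> x = h}"
    by blast
  then obtain n h where nh: "\<And>F. F facet_of P \<Longrightarrow> norm (n F) = 1 \<and> P \<subseteq> {x. h F \<le> n F \<bullet> x} \<and>
      F = P \<inter> {x. n F \<bullet> x = h F}"
    unfolding choice_iff by blast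
  let ?T = "{F. F facet_of P \<and> v \<in> F}"
  have "dim (n ` ?T) \<le> card ?T"
    using fin by (intro order.trans[OF dim_le_card'] card_image_le) auto
  then have "dim (n ` ?T) < DIM('a)" using less dim by simp
  then obtain u where u: "u \<noteq> 0" "\<And>x. x \<in> n ` ?T \<Longrightarrow> orthogonal u x"
    using orthogonal_to_subspace_exists span_base by metis
  \<comment> \<open>A neighbourhood of \<open>v\<close> where the inequalities of the facets missing
    \<open>v\<close> stay strict.\<close>
  let ?U = "\<Inter>F\<in>{F. F facet_of P \<and> v \<notin> F}. {x. h F < n F \<bullet> x}"
  have "v \<in> P" using P(3) by (simp add: extreme_point_of_def)
  then have "v \<in> ?U" using nh by (force simp: less_le)
  moreover have "open ?U" using fin by (intro open_INT) (auto simp: open_halfspace_gt)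
  ultimately obtain e where e: "e > 0" "cball v e \<subseteq> ?U" using open_contains_cball by blast
  obtain x where x: "x \<in> interior P" using P(2) by auto
  have seg: "v + t *\<^sub>R u \<in> P" if "norm (t *\<^sub>R u) \<le> e" for t
  proof (rule ccontr)
    assume "v + t *\<^sub>R u \<notin> P"
    then obtain F where F: "F facet_of P"
      "\<And>n h. n \<noteq> 0 \<Longrightarrow> P \<subseteq> {x. h \<le> n \<bullet> x} \<Longrightarrow> F \<subseteq> {x. n \<bullet> x = h} \<Longrightarrow> n \<bullet> (v + t *\<^sub>R u) < h"
      using separating_facet[OF ph x] by blast
    have "n F \<noteq> 0" using nh[OF F(1)] by auto
    then have lt: "n F \<bullet> (v + t *\<^sub>R u) < h F" using F(2) nh[OF F(1)] by blast
    show False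
    proof (cases "v \<in> F")
      case True
      then have "orthogonal u (n F)" "n F \<bullet> v = h F" using u F(1) nh by blast+
      then show False using lt by (simp add: inner_add_right orthogonal_def inner_commute)
    next
      case False
      have "v + t *\<^sub>R u \<in> cball v e" using that by (simp add: dist_norm)
      then show False using e False F(1) lt by force
    qed
  qed
  have "v + (e / norm u) *\<^sub>R u \<in> P" "v + (- (e / norm u)) *\<^sub>R u \<in> P"
    using seg[of "e / norm u"] seg[of "- (e / norm u)"] e(1) u(1) by auto
  moreover have "v \<in> open_segment (v + (e / norm u) *\<^sub>R u) (v + (- (e / norm u)) *\<^sub>R u)"
  proof -
    have "v = midpoint (v + (e / norm u) *\<^sub>R u) (v + (- (e / norm u)) *\<^sub>R u)"
      by (simp add: midpoint_def flip: scaleR_2)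
    moreover have "v + (e / norm u) *\<^sub>R u \<noteq> v + (- (e / norm u)) *\<^sub>R u"
      using e(1) u(1) by (simp flip: scaleR_minus_left)
    ultimately show ?thesis by (metis midpoint_in_open_segment)
  qed
  ultimately show False using P(3) unfolding extreme_point_of_def by blast
qed

subsection \<open>Faces of unit cells\<close>

lemma maximal_face_iso:
  assumes bij: "bij_betw \<phi> {F. F face_of S} {G. G face_of T}"
    and ord: "\<And>F F'. F face_of S \<Longrightarrow> F' face_of S \<Longrightarrow> F \<subseteq> F' \<longleftrightarrow> \<phi> F \<subseteq> \<phi> F'"
    and "\<phi> S = T" "convex S" "F face_of S"
  shows "maximal_face S F \<longleftrightarrow> maximal_face T (\<phi> F)"
proof -
  have S: "S face_of S" using assms(4) by (rule face_of_refl)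
  have im: "\<phi> F' face_of T" if "F' face_of S" for F' using bij that bij_betwE by blast
  have eq: "\<phi> F' = \<phi> F'' \<longleftrightarrow> F' = F''" if "F' face_of S" "F'' face_of S" for F' F''
    using ord that by blast
  have "G face_of T \<longleftrightarrow> (\<exists>F'. F' face_of S \<and> G = \<phi> F')" for G
    using bij unfolding bij_betw_def by blast
  then have "(\<forall>G. G face_of T \<longrightarrow> \<phi> F \<subseteq> G \<longrightarrow> G = \<phi> F \<or> G = T) \<longleftrightarrow>
      (\<forall>F'. F' face_of S \<longrightarrow> \<phi> F \<subseteq> \<phi> F' \<longrightarrow> \<phi> F' = \<phi> F \<or> \<phi> F' = T)"
    by auto
  also have "\<dots> \<longleftrightarrow> (\<forall>F'. F' face_of S \<longrightarrow> F \<subseteq> F' \<longrightarrow> F' = F \<or> F' = S)"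
    using eq ord assms(3,5) S by auto
  finally show ?thesis
    using assms(3,5) im eq[OF assms(5) S] unfolding maximal_face_def by auto
qed

lemma card_faces_translation:
  fixes S :: "'a::euclidean_space set"
  shows "card {G. G face_of (+) c ` S} = card {F. F face_of S}"
proof -
  have "{G. G face_of (+) c ` S} = (`) ((+) c) ` {F. F face_of S}"
  proof (intro equalityI subsetI)
    fix G assume "G \<in> {G. G face_of (+) c ` S}"
    then have "G face_of (+) c ` S" by simp
    moreover have G: "G = (+) c ` ((+) (- c) ` G)" by (simp add: image_comp o_def)
    ultimately have "(+) (- c) ` G face_of S" using face_of_translation_eq by metis
    then show "G \<in> (`) ((+) c) ` {F. F face_of S}" using G by blast
  qed auto
  moreover have "inj_on ((`) ((+) c)) {F. F face_of S}"
    by (rule inj_on_image) simp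
  ultimately show ?thesis by (simp add: card_image)
qed

lemma mem_unit_cell: "x \<in> unit_cell k \<longleftrightarrow> (\<forall>i. real (k i) \<le> x $ i \<and> x $ i \<le> real (k i) + 1)"
  by (simp add: unit_cell_def mem_box_cart)

lemma unit_cell_inj:
  assumes "unit_cell k = unit_cell m"
  shows "k = m"
proof
  fix i
  have "(\<chi> i. real (k i)) \<in> unit_cell k" "(\<chi> i. real (m i)) \<in> unit_cell m"
    by (simp_all add: mem_unit_cell)
  then have "(\<chi> i. real (k i)) \<in> unit_cell m" "(\<chi> i. real (m i)) \<in> unit_cell k"
    by (simp_all add: assms)
  then have "real (m i) \<le> real (k i)" "real (k i) \<le> real (m i)"
    by (auto simp: mem_unit_cell)
  then show "k i = m i" by simp
qed

lemma convex_unit_cell: "convex (unit_cell k)"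
  by (simp add: unit_cell_def)

lemma polytope_unit_cell: "polytope (unit_cell k)"
  by (simp add: unit_cell_def polytope_interval)

lemma sum_Basis_nth: "(\<Sum>x\<in>Basis. (x :: real^'n) $ i) = 1"
proof -
  have "(\<Sum>x\<in>Basis. (x :: real^'n) $ i) = (\<Sum>x\<in>Basis. (x :: real^'n) \<bullet> axis i 1)"
    by (simp add: inner_axis)
  also have "\<dots> = (One :: real^'n) \<bullet> axis i 1" by (rule inner_sum_left[symmetric])
  also have "\<dots> = 1"
    using inner_sum_left_Basis[of "axis i (1::real)" "\<lambda>_. 1"] by (simp add: axis_in_Basis_iff)
  finally show ?thesis .
qed

text \<open>The unit cell is a translate of the standard cube. The count will show that the
  isomorphism of complexes maps the faces of a cell onto those of its unit cell.\<close>

lemma card_faces_cubical: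
  assumes "cubical_polytope C"
  shows "card {F. F face_of C} = card {G. G face_of unit_cell k}"
proof -
  have "unit_cell k = (+) (\<chi> i. real (k i)) ` cbox 0 One"
    unfolding unit_cell_def cbox_translation[symmetric]
    by (rule arg_cong2[of _ _ _ _ cbox]) (simp_all add: vec_eq_iff sum_Basis_nth)
  then have "card {G. G face_of unit_cell k} = card {G. G face_of (cbox 0 One :: (real^3) set)}"
    by (simp add: card_faces_translation)
  then show ?thesis
    using assms bij_betw_same_card unfolding cubical_polytope_def comb_equiv_def by metis
qed

section \<open>Facets and vertices of unit cells\<close>

definition unit_facet :: "(3 \<Rightarrow> nat) \<Rightarrow> 3 \<Rightarrow> bool \<Rightarrow> (real^3) set" where
  "unit_facet k i t = {x \<in> unit_cell k. x $ i = real (k i) + of_bool t}"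

text \<open>The vertices serve as test points that tell faces apart.\<close>

definition unit_vertex :: "(3 \<Rightarrow> nat) \<Rightarrow> (3 \<Rightarrow> bool) \<Rightarrow> real^3" where
  "unit_vertex k s = (\<chi> i. real (k i) + of_bool (s i))"

lemma unit_vertex_in_facet: "unit_vertex k s \<in> unit_facet k i t \<longleftrightarrow> s i = t"
  by (auto simp: unit_vertex_def unit_facet_def mem_unit_cell)

lemma unit_vertex_in_cell: "unit_vertex k s \<in> unit_cell k"
  by (auto simp: unit_vertex_def mem_unit_cell)

lemma unit_cell_slice_face:
  "\<lbrakk>t \<Longrightarrow> c = real (k i) + 1; \<not> t \<Longrightarrow> c = real (k i)\<rbrakk> \<Longrightarrow> {x \<in> unit_cell k. x $ i = c} face_of unit_cell k"
proof -
  assume c: "t \<Longrightarrow> c = real (k i) + 1" "\<not> t \<Longrightarrow> c = real (k i)"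
  have eq: "{x \<in> unit_cell k. x $ i = c} = unit_cell k \<inter> {x. axis i 1 \<bullet> x = c}"
    by (auto simp: inner_axis')
  show ?thesis unfolding eq
    using c by (cases t; intro face_of_Int_supporting_hyperplane_le face_of_Int_supporting_hyperplane_ge
      convex_unit_cell) (auto simp: mem_unit_cell inner_axis')
qed

lemma unit_facet_face: "unit_facet k i t face_of unit_cell k"
  unfolding unit_facet_def by (rule unit_cell_slice_face[of t]) auto

lemma unit_facet_subset_iff: "unit_facet k i t \<subseteq> unit_facet k j t' \<longleftrightarrow> i = j \<and> t = t'"
proof
  assume sub: "unit_facet k i t \<subseteq> unit_facet k j t'"
  have "s j = t'" if "s i = t" for s
    using subsetD[OF sub, of "unit_vertex k s"] that by (simp add: unit_vertex_in_facet)
  \<comment> \<open>This vertex avoids the facet \<open>(j, t')\<close> as soon as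
    \<open>j \<noteq> i\<close>, and for \<open>j = i\<close> it forces
    \<open>t = t'\<close>.\<close>
  from this[of "\<lambda>l. if l = i then t else \<not> t'"] show "i = j \<and> t = t'"
    by (auto split: if_splits)
qed auto

lemma unit_facet_neq_cell: "unit_facet k i t \<noteq> unit_cell k"
  using unit_vertex_in_cell[of k "\<lambda>_. \<not> t"] unit_vertex_in_facet[of k "\<lambda>_. \<not> t" i t] by auto

text \<open>A relative interior point of \<open>G\<close> lies on the boundary of the cell, hence on
  a facet; a face that contains a relative interior point of \<open>G\<close> contains
  \<open>G\<close>.\<close>

lemma unit_cell_proper_face:
  assumes G: "G face_of unit_cell k" "G \<noteq> unit_cell k"
  shows "\<exists>i t. G \<subseteq> unit_facet k i t"
proof (cases "G = {}")
  case False
  then obtain z where z: "z \<in> rel_interior G"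
    using face_of_imp_convex[OF G(1)] rel_interior_eq_empty by blast
  then have zG: "z \<in> G" using rel_interior_subset by blast
  then have zk: "z \<in> unit_cell k" using G(1) face_of_imp_subset by blast
  have "z \<notin> interior (unit_cell k)" using face_of_disjoint_interior[OF G] zG by blast
  then obtain i where "\<not> (real (k i) < z $ i \<and> z $ i < real (k i) + 1)"
    by (auto simp: unit_cell_def mem_box_cart)
  then have "z $ i = real (k i) + of_bool (z $ i = real (k i) + 1)"
    using zk unfolding mem_unit_cell by (smt (verit) of_bool_eq)
  then have "z \<in> unit_facet k i (z $ i = real (k i) + 1)"
    using zk by (simp add: unit_facet_def)
  then have "G \<subseteq> unit_facet k i (z $ i = real (k i) + 1)"
    using subset_of_face_of[OF unit_facet_face face_of_imp_subset[OF G(1)]] z by blast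
  then show ?thesis by blast
qed simp

lemma maximal_face_unit_cell:
  "maximal_face (unit_cell k) G \<longleftrightarrow> (\<exists>i t. G = unit_facet k i t)"
proof
  assume max: "maximal_face (unit_cell k) G"
  then have G: "G face_of unit_cell k" "G \<noteq> unit_cell k" by (simp_all add: maximal_face_def)
  obtain i t where "G \<subseteq> unit_facet k i t"
    using unit_cell_proper_face[OF G] by blast
  then have "unit_facet k i t = G \<or> unit_facet k i t = unit_cell k"
    using max unit_facet_face[of k i t] unfolding maximal_face_def by blast
  then show "\<exists>i t. G = unit_facet k i t"
    using unit_facet_neq_cell by auto
next
  assume "\<exists>i t. G = unit_facet k i t"
  then obtain i t where G: "G = unit_facet k i t" by blast
  show "maximal_face (unit_cell k) G"
    unfolding maximal_face_def
  proof (intro conjI allI impI)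
    fix G' assume G': "G' face_of unit_cell k" "G \<subseteq> G'"
    show "G' = G \<or> G' = unit_cell k"
    proof (rule disjCI)
      assume "G' \<noteq> unit_cell k"
      then obtain j t' where j: "G' \<subseteq> unit_facet k j t'" using unit_cell_proper_face[OF G'(1)] by blast
      then have "i = j \<and> t = t'" using G' G unit_facet_subset_iff[of k i t j t'] by blast
      then show "G' = G" using j G' G by blast
    qed
  qed (simp_all add: G unit_facet_face unit_facet_neq_cell)
qed

text \<open>In each coordinate the other cell cuts out the whole cell, a facet or nothing, according
  to whether the indices agree, differ by one or differ by more.\<close>

lemma unit_cell_Int_face: "unit_cell k \<inter> unit_cell m face_of unit_cell k"
proof -
  have "unit_cell k \<inter> unit_cell m = (\<Inter>i. {x \<in> unit_cell k. real (m i) \<le> x $ i \<and> x $ i \<le> real (m i) + 1})"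
    by (auto simp: mem_unit_cell)
  moreover have "{x \<in> unit_cell k. real (m i) \<le> x $ i \<and> x $ i \<le> real (m i) + 1} face_of unit_cell k" for i
  proof -
    have bnd: "real (k i) \<le> x $ i" "x $ i \<le> real (k i) + 1" if "x \<in> unit_cell k" for x
      using that by (simp_all add: mem_unit_cell)
    consider "k i = m i" | "k i = Suc (m i)" | "m i = Suc (k i)" | "k i > Suc (m i)" | "m i > Suc (k i)"
      by linarith
    then show ?thesis
    proof cases
      case 1
      then have "{x \<in> unit_cell k. real (m i) \<le> x $ i \<and> x $ i \<le> real (m i) + 1} = unit_cell k"
        using bnd by auto
      then show ?thesis by (simp add: face_of_refl convex_unit_cell)
    next
      case 2
      then have "{x \<in> unit_cell k. real (m i) \<le> x $ i \<and> x $ i \<le> real (m i) + 1} = unit_facet k i False"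
        using bnd by (fastforce simp: unit_facet_def)
      then show ?thesis by (simp add: unit_facet_face)
    next
      case 3
      then have "{x \<in> unit_cell k. real (m i) \<le> x $ i \<and> x $ i \<le> real (m i) + 1} = unit_facet k i True"
        using bnd by (fastforce simp: unit_facet_def)
      then show ?thesis by (simp add: unit_facet_face)
    next
      case 4
      then have "real (k i) > real (m i) + 1" by linarith
      then have empty: "{x \<in> unit_cell k. real (m i) \<le> x $ i \<and> x $ i \<le> real (m i) + 1} = {}"
        using bnd by fastforce
      show ?thesis unfolding empty by simp
    next
      case 5
      then have "real (m i) > real (k i) + 1" by linarith
      then have empty: "{x \<in> unit_cell k. real (m i) \<le> x $ i \<and> x $ i \<le> real (m i) + 1} = {}"
        using bnd by fastforce
      show ?thesis unfolding empty by simp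
    qed
  qed
  ultimately show ?thesis by (auto intro!: face_of_Inter)
qed

subsection \<open>The polytope cut by the planes\<close>

definition corner_index :: "(3 \<Rightarrow> bool) \<Rightarrow> 3 \<Rightarrow> nat" where
  "corner_index s i = (if s i then 2 else 0)"

lemma corner_index_mem: "corner_index s \<in> cell_indices"
  by (simp add: corner_index_def cell_indices_def)

lemma corner_index_inj: "corner_index s = corner_index s' \<Longrightarrow> s = s'"
  by (auto simp: corner_index_def fun_eq_iff split: if_splits)

text \<open>The cutting plane of pair \<open>i\<close> that bounds the corner cells with \<open>s i = t\<close>; its unit normal
  points into them.\<close>

definition inner_normal :: "(3 \<Rightarrow> nat \<Rightarrow> real^3) \<Rightarrow> 3 \<Rightarrow> bool \<Rightarrow> real^3" where
  "inner_normal a i t = (if t then a i 1 /\<^sub>R norm (a i 1) else - a i 0 /\<^sub>R norm (a i 0))"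

definition inner_offset :: "(3 \<Rightarrow> nat \<Rightarrow> real^3) \<Rightarrow> (3 \<Rightarrow> nat \<Rightarrow> real) \<Rightarrow> 3 \<Rightarrow> bool \<Rightarrow> real" where
  "inner_offset a b i t = (if t then b i 1 / norm (a i 1) else - b i 0 / norm (a i 0))"

text \<open>\<open>Out i False\<close> and \<open>Out i True\<close> are the facets of \<open>P\<close> below and above the \<open>i\<close>-th pair of
  planes, with inward unit normals \<open>N\<close>.\<close>

locale cut_polytope =
  fixes P :: "(real^3) set" and a :: "3 \<Rightarrow> nat \<Rightarrow> real^3" and b :: "3 \<Rightarrow> nat \<Rightarrow> real"
    and Out :: "3 \<Rightarrow> bool \<Rightarrow> (real^3) set" and N :: "3 \<Rightarrow> bool \<Rightarrow> real^3" and H :: "3 \<Rightarrow> bool \<Rightarrow> real"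
    and \<phi> :: "(real^3) set \<Rightarrow> (real^3) set" and X Y :: "(real^3) set set"
  assumes polytope_P: "polytope P"
    and a_nonzero: "\<And>i j. j < 2 \<Longrightarrow> a i j \<noteq> 0"
    and facet_P: "\<And>S. S facet_of P \<longleftrightarrow> (\<exists>i t. S = Out i t)"
    and disjoint: "\<And>i. Out i False \<inter> Out i True = {}"
    and side: "\<And>i t j x. x \<in> Out i t \<Longrightarrow> j < 2 \<Longrightarrow> (if t then b i j \<le> a i j \<bullet> x else a i j \<bullet> x \<le> b i j)"
    and cover: "P \<subseteq> \<Union>(cells P a b)"
    and cubical: "\<And>k. k \<in> cell_indices \<Longrightarrow> cubical_polytope (cell P a b k)"
    and X_def: "X = (\<Union>k\<in>cell_indices. {F. F face_of cell P a b k})"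
    and Y_def: "Y = (\<Union>k\<in>cell_indices. {G. G face_of unit_cell k})"
    and \<phi>_bij: "bij_betw \<phi> X Y"
    and \<phi>_ord: "\<And>F F'. F \<in> X \<Longrightarrow> F' \<in> X \<Longrightarrow> F \<subseteq> F' \<longleftrightarrow> \<phi> F \<subseteq> \<phi> F'"
    and \<phi>_cell: "\<And>k. k \<in> cell_indices \<Longrightarrow> \<phi> (cell P a b k) = unit_cell k"
    and norm_N: "\<And>i t. norm (N i t) = 1"
    and P_halfspace: "\<And>i t. P \<subseteq> {x. H i t \<le> N i t \<bullet> x}"
    and Out_eq: "\<And>i t. Out i t = P \<inter> {x. N i t \<bullet> x = H i t}"
begin

abbreviation C :: "(3 \<Rightarrow> nat) \<Rightarrow> (real^3) set" where "C \<equiv> cell P a b"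

abbreviation D :: "(3 \<Rightarrow> bool) \<Rightarrow> (real^3) set" where "D s \<equiv> C (corner_index s)"

section \<open>Transfer of faces between cells and unit cells\<close>

lemma polytope_C: "k \<in> cell_indices \<Longrightarrow> polytope (C k)"
  using cubical by (simp add: cubical_polytope_def)

lemma convex_C: "k \<in> cell_indices \<Longrightarrow> convex (C k)"
  by (simp add: polytope_C polytope_imp_convex)

lemma face_X: "F face_of C k \<Longrightarrow> k \<in> cell_indices \<Longrightarrow> F \<in> X"
  by (auto simp: X_def)

lemma C_X: "k \<in> cell_indices \<Longrightarrow> C k \<in> X"
  by (rule face_X) (simp_all add: face_of_refl convex_C)

lemma \<phi>_eq_iff: "F \<in> X \<Longrightarrow> F' \<in> X \<Longrightarrow> \<phi> F = \<phi> F' \<longleftrightarrow> F = F'"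
  using \<phi>_bij by (auto simp: bij_betw_def dest: inj_onD)

lemma C_inj: "k \<in> cell_indices \<Longrightarrow> m \<in> cell_indices \<Longrightarrow> C k = C m \<Longrightarrow> k = m"
  using \<phi>_cell unit_cell_inj by metis

lemma empty_X: "{} \<in> X"
  using face_X[OF empty_face_of corner_index_mem] .

lemma \<phi>_empty: "\<phi> {} = {}"
proof -
  have "{} \<in> Y" using corner_index_mem by (auto simp: Y_def)
  then obtain F where "F \<in> X" "\<phi> F = {}" using \<phi>_bij by (metis bij_betw_imp_surj_on imageE)
  then show ?thesis using \<phi>_ord[OF empty_X, of F] by simp
qed

text \<open>A priori \<open>\<phi> F\<close> is a face of some unit cell \<open>m\<close>. Lying
  also in the unit cell \<open>k\<close>, it is a face of the intersection of both, which is a face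
  of the latter.\<close>

lemma \<phi>_face:
  assumes k: "k \<in> cell_indices" and F: "F face_of C k"
  shows "\<phi> F face_of unit_cell k"
proof -
  have "\<phi> F \<in> Y" using \<phi>_bij face_X[OF F k] by (rule bij_betwE[THEN bspec])
  then obtain m where m: "\<phi> F face_of unit_cell m" by (auto simp: Y_def)
  have "\<phi> F \<subseteq> unit_cell k"
    using \<phi>_ord[OF face_X[OF F k] C_X[OF k]] \<phi>_cell[OF k] face_of_imp_subset[OF F] by simp
  then have "\<phi> F face_of unit_cell m \<inter> unit_cell k"
    using m face_of_imp_subset[OF m] by (intro face_of_subset[OF m]) auto
  then show ?thesis
    using face_of_trans unit_cell_Int_face[of k m] by (simp add: Int_commute)
qed

text \<open>Surjectivity holds by counting, as both polytopes have as many faces as a cube.\<close>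

lemma \<phi>_faces_bij:
  assumes k: "k \<in> cell_indices"
  shows "bij_betw \<phi> {F. F face_of C k} {G. G face_of unit_cell k}"
proof -
  have inj: "inj_on \<phi> {F. F face_of C k}"
    using \<phi>_eq_iff face_X k by (auto intro!: inj_onI)
  moreover have "\<phi> ` {F. F face_of C k} = {G. G face_of unit_cell k}"
  proof (rule card_subset_eq)
    show "finite {G. G face_of unit_cell k}" by (rule finite_polytope_faces[OF polytope_unit_cell])
    show "card (\<phi> ` {F. F face_of C k}) = card {G. G face_of unit_cell k}"
      using card_faces_cubical[OF cubical[OF k]] inj by (simp add: card_image)
  qed (use \<phi>_face[OF k] in auto)
  ultimately show ?thesis by (simp add: bij_betw_def)
qed

text \<open>One inverse serves all cells: a face shared by several unit cells has a single preimage,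
  which is a face of each corresponding cell.\<close>

definition \<psi> :: "(real^3) set \<Rightarrow> (real^3) set" where
  "\<psi> = inv_into X \<phi>"

lemma \<psi>:
  assumes k: "k \<in> cell_indices" and G: "G face_of unit_cell k"
  shows \<psi>_face: "\<psi> G face_of C k" and \<phi>_\<psi>: "\<phi> (\<psi> G) = G"
proof -
  have "G \<in> \<phi> ` {F. F face_of C k}"
    using \<phi>_faces_bij[OF k] G by (simp add: bij_betw_def)
  then obtain F where F: "F face_of C k" "\<phi> F = G" by blast
  then have "\<psi> G = F"
    using inv_into_f_f[OF bij_betw_imp_inj_on[OF \<phi>_bij] face_X[OF F(1) k]] by (simp add: \<psi>_def)
  then show "\<psi> G face_of C k" "\<phi> (\<psi> G) = G" using F by auto
qed

lemma \<psi>_mono: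
  assumes "k \<in> cell_indices" "G face_of unit_cell k" "m \<in> cell_indices" "G' face_of unit_cell m"
  shows "\<psi> G \<subseteq> \<psi> G' \<longleftrightarrow> G \<subseteq> G'"
  using \<phi>_ord[OF face_X[OF \<psi>_face[OF assms(1,2)] assms(1)] face_X[OF \<psi>_face[OF assms(3,4)] assms(3)]]
  by (simp add: \<phi>_\<psi>[OF assms(1,2)] \<phi>_\<psi>[OF assms(3,4)])

lemma \<psi>_nonempty:
  assumes "k \<in> cell_indices" "G face_of unit_cell k" "G \<noteq> {}"
  shows "\<psi> G \<noteq> {}"
  using \<phi>_\<psi>[OF assms(1,2)] assms(3) \<phi>_empty by auto

text \<open>A flag of the unit cell (empty face, vertex, edge, facet, cell) yields a chain of five
  faces of strictly increasing dimension. It starts at -1 or more, so the cell has dimension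
  3.\<close>

lemma interior_C:
  assumes k: "k \<in> cell_indices"
  shows "interior (C k) \<noteq> {}"
proof -
  have step: "aff_dim (\<psi> G) < aff_dim (\<psi> G')"
    if "G face_of unit_cell k" "G' face_of unit_cell k" "G \<subset> G'" for G G'
  proof (rule face_of_aff_dim_lt)
    note f = \<psi>_face[OF k that(1)] \<psi>_face[OF k that(2)]
    show "convex (\<psi> G')" using f(2) by (rule face_of_imp_convex)
    show "\<psi> G face_of \<psi> G'"
      using \<psi>_mono[OF k that(1) k that(2)] that(3) face_of_imp_subset[OF f(2)]
      by (intro face_of_subset[OF f(1)]) auto
    show "\<psi> G \<noteq> \<psi> G'" using \<psi>_mono[OF k that(2) k that(1)] that(3) by blast
  qed
  let ?f = "\<lambda>i. unit_facet k i False"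
  note f = unit_facet_face[of k _ False]
  have uv: "unit_vertex k s \<in> ?f i \<longleftrightarrow> \<not> s i" for s i
    by (simp add: unit_vertex_in_facet)
  have psub: "A \<subset> B" if "A \<subseteq> B" "x \<in> B" "x \<notin> A" for A B and x :: "real^3" using that by blast
  \<comment> \<open>Strictness is witnessed by a vertex of the larger face outside the smaller
    one.\<close>
  have d0: "aff_dim (\<psi> {}) < aff_dim (\<psi> (?f 1 \<inter> ?f 2 \<inter> ?f 3))"
    by (intro step psub[of _ _ "unit_vertex k (\<lambda>_. False)"]) (simp_all add: uv f face_of_Int)
  have d1: "aff_dim (\<psi> (?f 1 \<inter> ?f 2 \<inter> ?f 3)) < aff_dim (\<psi> (?f 1 \<inter> ?f 2))"
    by (intro step psub[of _ _ "unit_vertex k (\<lambda>i. i = 3)"]) (auto simp: uv f face_of_Int)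
  have d2: "aff_dim (\<psi> (?f 1 \<inter> ?f 2)) < aff_dim (\<psi> (?f 1))"
    by (intro step psub[of _ _ "unit_vertex k (\<lambda>i. i = 2)"]) (auto simp: uv f face_of_Int)
  have d3: "aff_dim (\<psi> (?f 1)) < aff_dim (\<psi> (unit_cell k))"
    using unit_facet_neq_cell[of k 1 False] face_of_imp_subset[OF f[of 1]]
    by (intro step) (auto simp: f face_of_refl convex_unit_cell)
  have d4: "aff_dim (\<psi> (unit_cell k)) \<le> aff_dim (C k)"
    using \<psi>_face[OF k face_of_refl[OF convex_unit_cell]] by (intro aff_dim_subset face_of_imp_subset)
  have "aff_dim (C k) \<ge> 3"
    using aff_dim_geq[of "\<psi> {}"] d0 d1 d2 d3 d4 by linarith
  then have "aff_dim (C k) = 3" using aff_dim_le_DIM[of "C k"] by simp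
  then show ?thesis
    using interior_rel_interior_gen[of "C k"] rel_interior_eq_empty[OF convex_C[OF k]] by auto
qed

lemma C_subset_P: "C k \<subseteq> P"
  by (auto simp: cell_def)

lemma C_side:
  "x \<in> C k \<Longrightarrow> j < 2 \<Longrightarrow> (if j < k i then b i j \<le> a i j \<bullet> x else a i j \<bullet> x \<le> b i j)"
  unfolding cell_def by blast

text \<open>A cutting plane with both cells on the same side imposes nothing new; one that separates
  them forces equality and supports \<open>C k\<close>. So the intersection is an intersection of
  faces.\<close>

lemma C_Int_face:
  assumes k: "k \<in> cell_indices"
  shows "C k \<inter> C m face_of C k"
proof -
  let ?T = "\<lambda>(i, j). if (j < k i) = (j < m i) then C k else C k \<inter> {x. a i j \<bullet> x = b i j}"
  have "C k \<inter> C m = \<Inter> (?T ` (UNIV \<times> {..<2}))"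
  proof (intro equalityI subsetI)
    fix x assume x: "x \<in> C k \<inter> C m"
    have "x \<in> ?T (i, j)" if "j < 2" for i j
      using C_side[of x k j i] C_side[of x m j i] x that by (auto split: if_splits)
    then show "x \<in> \<Inter> (?T ` (UNIV \<times> {..<2}))" by blast
  next
    fix x assume x: "x \<in> \<Inter> (?T ` (UNIV \<times> {..<2}))"
    have T: "x \<in> ?T (i, j)" if "j < 2" for i j using x that by blast
    have xk: "x \<in> C k" using T[of 0 1] by (auto split: if_splits)
    moreover have "if j < m i then b i j \<le> a i j \<bullet> x else a i j \<bullet> x \<le> b i j" if "j < 2" for i j
      using T[OF that, of i] C_side[OF xk that, of i] by (auto split: if_splits)
    ultimately show "x \<in> C k \<inter> C m" using C_subset_P by (auto simp: cell_def)
  qed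
  moreover have T_face: "?T (i, j) face_of C k" if "j < 2" for i j
  proof (cases "j < k i")
    case True
    then have "C k \<inter> {x. a i j \<bullet> x = b i j} face_of C k"
      using C_side[OF _ that, of _ k i] convex_C[OF k]
      by (intro face_of_Int_supporting_hyperplane_ge) auto
    then show ?thesis by (simp add: face_of_refl convex_C[OF k])
  next
    case False
    then have "C k \<inter> {x. a i j \<bullet> x = b i j} face_of C k"
      using C_side[OF _ that, of _ k i] convex_C[OF k]
      by (intro face_of_Int_supporting_hyperplane_le) auto
    then show ?thesis by (simp add: face_of_refl convex_C[OF k])
  qed
  have "\<Inter> (?T ` (UNIV \<times> {..<2})) face_of C k"
  proof (rule face_of_Inter)
    show "?T ` (UNIV \<times> {..<2}) \<noteq> {}" by (simp add: lessThan_empty_iff)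
    show "T face_of C k" if "T \<in> ?T ` (UNIV \<times> {..<2})" for T using that T_face by blast
  qed
  ultimately show ?thesis by simp
qed

section \<open>Facets of the corner cells\<close>

text \<open>For \<open>t = s i\<close> this will be an outer facet, on the boundary of
  \<open>P\<close>; for \<open>t = (\<not> s i)\<close> an inner one, on a cutting plane.\<close>

definition S :: "(3 \<Rightarrow> bool) \<Rightarrow> 3 \<Rightarrow> bool \<Rightarrow> (real^3) set" where
  "S s i t = \<psi> (unit_facet (corner_index s) i t)"

lemma S_face: "S s i t face_of D s" and \<phi>_S: "\<phi> (S s i t) = unit_facet (corner_index s) i t"
  unfolding S_def by (rule \<psi>[OF corner_index_mem unit_facet_face])+

lemma S_X: "S s i t \<in> X"
  using face_X[OF S_face corner_index_mem] .

lemma S_inj: "S s i t = S s j t' \<longleftrightarrow> i = j \<and> t = t'"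
  using \<phi>_ord[OF S_X S_X, of s i t s j t'] \<phi>_ord[OF S_X S_X, of s j t' s i t]
  by (auto simp: \<phi>_S unit_facet_subset_iff)

lemma S_nonempty: "S s i t \<noteq> {}"
  unfolding S_def using unit_vertex_in_facet[of _ "\<lambda>_. t" i t]
  by (intro \<psi>_nonempty[OF corner_index_mem unit_facet_face]) blast

lemma maximal_face_D: "maximal_face (D s) F \<longleftrightarrow> (\<exists>i t. F = S s i t)"
proof -
  have iso: "maximal_face (D s) F \<longleftrightarrow> (\<exists>i t. F = S s i t)" if F: "F face_of D s"
  proof -
    have "maximal_face (D s) F \<longleftrightarrow> maximal_face (unit_cell (corner_index s)) (\<phi> F)"
    proof (rule maximal_face_iso[OF \<phi>_faces_bij[OF corner_index_mem]])
      show "F \<subseteq> F' \<longleftrightarrow> \<phi> F \<subseteq> \<phi> F'" if "F face_of D s" "F' face_of D s" for F F'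
        using that by (intro \<phi>_ord face_X[OF _ corner_index_mem])
    qed (simp_all add: \<phi>_cell corner_index_mem convex_C F)
    also have "\<dots> \<longleftrightarrow> (\<exists>i t. \<phi> F = \<phi> (S s i t))"
      by (simp add: maximal_face_unit_cell \<phi>_S)
    also have "\<dots> \<longleftrightarrow> (\<exists>i t. F = S s i t)"
      by (simp add: \<phi>_eq_iff[OF face_X[OF F corner_index_mem] S_X])
    finally show ?thesis .
  qed
  show ?thesis
  proof (cases "F face_of D s")
    case False
    then show ?thesis using S_face by (auto simp: maximal_face_def)
  qed (rule iso)
qed

lemma facet_D: "F facet_of D s \<longleftrightarrow> (\<exists>i t. F = S s i t)"
proof
  assume "F facet_of D s"
  then show "\<exists>i t. F = S s i t"
    using facet_imp_maximal_face[OF convex_C[OF corner_index_mem]] maximal_face_D by blast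
next
  assume "\<exists>i t. F = S s i t"
  then have "maximal_face (D s) F" "F \<noteq> {}" using maximal_face_D S_nonempty by auto
  then show "F facet_of D s"
    by (rule maximal_face_imp_facet[OF polytope_imp_polyhedron[OF polytope_C[OF corner_index_mem]]])
qed

lemma norm_inner_normal: "norm (inner_normal a i t) = 1"
  using a_nonzero[of 0 i] a_nonzero[of 1 i] by (simp add: inner_normal_def)

lemma inner_halfspace_iff:
  "inner_offset a b i t \<le> inner_normal a i t \<bullet> x \<longleftrightarrow> (if t then b i 1 \<le> a i 1 \<bullet> x else a i 0 \<bullet> x \<le> b i 0)"
  "inner_normal a i t \<bullet> x \<le> inner_offset a b i t \<longleftrightarrow> (if t then a i 1 \<bullet> x \<le> b i 1 else b i 0 \<le> a i 0 \<bullet> x)"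
  using a_nonzero[of 0 i] a_nonzero[of 1 i]
  by (auto simp: inner_normal_def inner_offset_def divide_simps)

lemma D_inner_halfspace: "D s \<subseteq> {x. inner_offset a b i (s i) \<le> inner_normal a i (s i) \<bullet> x}"
  using C_side[of _ "corner_index s" 0 i] C_side[of _ "corner_index s" 1 i]
  unfolding inner_halfspace_iff by (auto simp: corner_index_def)

lemma D_outer_halfspace: "D s \<subseteq> {x. H i t \<le> N i t \<bullet> x}"
  using C_subset_P P_halfspace by (rule order.trans)

lemma D_section:
  assumes "norm n = 1" "D s \<subseteq> {x. h \<le> n \<bullet> x}" "S s i t \<subseteq> {x. n \<bullet> x = h}"
  shows "S s i t = D s \<inter> {x. n \<bullet> x = h}"
  using assms maximal_face_D
  by (intro maximal_face_eq_hyperplane_section[OF convex_C[OF corner_index_mem] interior_C[OF corner_index_mem]]) auto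

text \<open>The facet is shared with the neighbour \<open>?m\<close>, the middle cell in direction
  \<open>i\<close>, which lies on the other side of the cutting plane.\<close>

lemma inner_facet:
  "S s i (\<not> s i) = D s \<inter> {x. inner_normal a i (s i) \<bullet> x = inner_offset a b i (s i)}"
proof (rule D_section)
  let ?k = "corner_index s" and ?m = "(corner_index s)(i := 1)"
  have m: "?m \<in> cell_indices" using corner_index_mem[of s] by (auto simp: cell_indices_def)
  have "unit_facet ?k i (\<not> s i) \<subseteq> unit_cell ?m"
    by (auto simp: unit_facet_def mem_unit_cell corner_index_def)
  then have "S s i (\<not> s i) \<subseteq> C ?m"
    using \<phi>_ord[OF S_X[of s i "\<not> s i"] C_X[OF m]] unfolding \<phi>_S \<phi>_cell[OF m] by blast
  then have mem: "x \<in> D s" "x \<in> C ?m" if "x \<in> S s i (\<not> s i)" for x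
    using that face_of_imp_subset[OF S_face] by blast+
  show "S s i (\<not> s i) \<subseteq> {x. inner_normal a i (s i) \<bullet> x = inner_offset a b i (s i)}"
  proof
    fix x assume "x \<in> S s i (\<not> s i)"
    note x = mem[OF this]
    have "inner_offset a b i (s i) \<le> inner_normal a i (s i) \<bullet> x"
      using D_inner_halfspace x(1) by blast
    moreover have "inner_normal a i (s i) \<bullet> x \<le> inner_offset a b i (s i)"
      using C_side[OF x(2), of 0 i] C_side[OF x(2), of 1 i] by (simp add: inner_halfspace_iff)
    ultimately show "x \<in> {x. inner_normal a i (s i) \<bullet> x = inner_offset a b i (s i)}" by simp
  qed
qed (simp_all add: norm_inner_normal D_inner_halfspace)

lemma interior_P: "interior P \<noteq> {}"
  using interior_C[OF corner_index_mem] interior_mono[OF C_subset_P] by blast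

text \<open>Otherwise another cell would cover a neighbourhood of an interior point of the facet on its
  far side, and the facet would belong to that cell too.\<close>

lemma outer_facet_frontier: "interior P \<inter> rel_interior (S s i (s i)) = {}"
proof (rule ccontr)
  assume "\<not> ?thesis"
  then obtain y where y: "y \<in> S s i (s i)" "y \<in> interior P" "y \<in> rel_interior (S s i (s i))"
    using rel_interior_subset by blast
  let ?k = "corner_index s"
  let ?Z = "\<Union>m \<in> cell_indices - {?k}. C m"
  have "y \<in> ?Z"
  proof (rule ccontr)
    assume "y \<notin> ?Z"
    have "finite (cell_indices)"
    proof -
      have "cell_indices = (UNIV :: 3 set) \<rightarrow>\<^sub>E {..<3}"
        by (auto simp: cell_indices_def PiE_def extensional_def)
      then show ?thesis using finite_PiE[of "UNIV :: 3 set" "\<lambda>_. {..<3::nat}"] by simp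
    qed
    then have "closed ?Z"
      by (intro closed_UN) (auto intro: polytope_imp_closed polytope_C)
    then have "open (interior P - ?Z)" by (simp add: open_Diff)
    moreover have "interior P - ?Z \<subseteq> D s"
      using cover interior_subset[of P] by (auto simp: cells_def)
    ultimately have "y \<in> interior (D s)"
      using y(2) \<open>y \<notin> ?Z\<close> by (intro interiorI[of "interior P - ?Z"]) auto
    moreover have "S s i (s i) \<noteq> D s" using maximal_face_D unfolding maximal_face_def by metis
    ultimately show False using face_of_disjoint_interior[OF S_face] y(1) by blast
  qed
  then obtain m where m: "m \<in> cell_indices" "m \<noteq> ?k" "y \<in> C m" by auto
  have "S s i (s i) \<subseteq> D s \<inter> C m"
  proof (rule subset_of_face_of[OF C_Int_face[OF corner_index_mem] face_of_imp_subset[OF S_face]])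
    show "D s \<inter> C m \<inter> rel_interior (S s i (s i)) \<noteq> {}"
      using y m(3) face_of_imp_subset[OF S_face[of s i "s i"]] by blast
  qed
  then have sub: "unit_facet ?k i (s i) \<subseteq> unit_cell m"
    using \<phi>_ord[OF S_X C_X[OF m(1)]] by (simp add: \<phi>_S \<phi>_cell[OF m(1)])
  \<comment> \<open>At \<open>j = i\<close> the facet has the extreme coordinate 0 or 3, which only
    one index allows; in the other directions its vertices take both \<open>?k j\<close> and
    \<open>?k j + 1\<close>.\<close>
  have "m j = ?k j" for j
  proof -
    have *: "unit_vertex ?k u \<in> unit_cell m" if "u i = s i" for u
      using subsetD[OF sub] that by (simp add: unit_vertex_in_facet)
    have "m j < 3" using m(1) by (simp add: cell_indices_def)
    then show ?thesis
      using *[of s] *[of "\<lambda>l. if l = i then s i else \<not> s l"]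
      by (auto simp: mem_unit_cell unit_vertex_def corner_index_def dest!: spec[of _ j] split: if_splits)
  qed
  then show False using m(2) by auto
qed

text \<open>A relative interior point of the outer facet lies on the boundary of \<open>P\<close>,
  hence on some \<open>Out j t\<close>, which then contains the whole facet. The direction
  \<open>j\<close> may differ from \<open>i\<close>, since the isomorphism is not tied to the
  numbering of the pairs.\<close>

lemma outer_facet_ex: "\<exists>j. S s i (s i) = D s \<inter> {x. N j (s j) \<bullet> x = H j (s j)}"
proof -
  have "rel_interior (S s i (s i)) \<noteq> {}"
    using S_nonempty face_of_imp_convex[OF S_face] rel_interior_eq_empty by blast
  then obtain y where y: "y \<in> rel_interior (S s i (s i))" by auto
  have sP: "S s i (s i) \<subseteq> P" using face_of_imp_subset[OF S_face] C_subset_P by blast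
  have yS: "y \<in> S s i (s i)" using y rel_interior_subset by blast
  then have "y \<in> P - rel_interior P"
    using y sP outer_facet_frontier[of s i] rel_interior_nonempty_interior[OF interior_P] by auto
  then obtain j t where jt: "y \<in> Out j t"
    using rel_boundary_of_polyhedron[OF polytope_imp_polyhedron[OF polytope_P]] facet_P by auto
  have "Out j t face_of P" using facet_P facet_of_imp_face_of by blast
  then have sub: "S s i (s i) \<subseteq> Out j t"
    using subset_of_face_of[OF _ sP] y jt by blast
  \<comment> \<open>The opposite facet of \<open>P\<close> lies across the inner plane of direction
    \<open>j\<close>, so the outer facet would lie in that plane and coincide with an inner
    facet.\<close>
  have "t = s j"
  proof (rule ccontr)
    assume t: "t \<noteq> s j"
    have "x \<in> {x. inner_normal a j (s j) \<bullet> x = inner_offset a b j (s j)}" if "x \<in> S s i (s i)" for x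
    proof -
      have "x \<in> Out j t" "x \<in> D s" using that sub face_of_imp_subset[OF S_face] by blast+
      then show ?thesis
        using side[of x j t 0] side[of x j t 1] D_inner_halfspace[of s j] t
        by (auto intro!: antisym simp: inner_halfspace_iff)
    qed
    then have "S s i (s i) = S s j (\<not> s j)"
      unfolding inner_facet by (intro D_section) (auto simp: norm_inner_normal dest: D_inner_halfspace[THEN subsetD])
    then show False by (auto simp: S_inj)
  qed
  then have "S s i (s i) = D s \<inter> {x. N j (s j) \<bullet> x = H j (s j)}"
    using sub \<open>t = s j\<close> by (intro D_section norm_N D_outer_halfspace) (auto simp: Out_eq)
  then show ?thesis by blast
qed

text \<open>Distinct facets need distinct planes, so \<open>\<pi>\<close> is injective, hence
  bijective on a finite type. Thus all three planes of \<open>P\<close> on the side \<open>s\<close>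
  carry facets of the cell.\<close>

lemma outer_facets:
  obtains \<pi> where "bij \<pi>" "\<And>i. S s i (s i) = D s \<inter> {x. N (\<pi> i) (s (\<pi> i)) \<bullet> x = H (\<pi> i) (s (\<pi> i))}"
proof -
  obtain \<pi> where \<pi>: "\<And>i. S s i (s i) = D s \<inter> {x. N (\<pi> i) (s (\<pi> i)) \<bullet> x = H (\<pi> i) (s (\<pi> i))}"
    using outer_facet_ex by metis
  have "inj \<pi>"
  proof (rule injI)
    fix i j assume "\<pi> i = \<pi> j"
    then have "S s i (s i) = S s j (s j)" using \<pi> by simp
    then show "i = j" by (simp add: S_inj)
  qed
  then have "bij \<pi>" by (simp add: bij_def finite_UNIV_inj_surj)
  then show thesis using that \<pi> by blast
qed

lemma outer_facet: "\<exists>i. D s \<inter> {x. N j (s j) \<bullet> x = H j (s j)} = S s i (s i)"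
proof -
  obtain \<pi> where \<pi>: "bij \<pi>" "\<And>i. S s i (s i) = D s \<inter> {x. N (\<pi> i) (s (\<pi> i)) \<bullet> x = H (\<pi> i) (s (\<pi> i))}"
    using outer_facets[of s] by blast
  have "\<pi> (inv \<pi> j) = j" using \<pi>(1) by (simp add: bij_is_surj surj_f_inv_f)
  then show ?thesis using \<pi>(2)[of "inv \<pi> j"] by auto
qed

text \<open>In an index \<open>(i, w)\<close>, \<open>w\<close> chooses between the facet plane of
  \<open>P\<close> and the cutting plane next to it.\<close>

lemma facet_system_D:
  "facet_system (D s) (\<lambda>(i, w). if w then N i (s i) else inner_normal a i (s i))
     (\<lambda>(i, w). if w then H i (s i) else inner_offset a b i (s i))"
proof
  let ?n = "\<lambda>(i, w). if w then N i (s i) else inner_normal a i (s i)"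
  let ?h = "\<lambda>(i, w). if w then H i (s i) else inner_offset a b i (s i)"
  show "polytope (D s)" "interior (D s) \<noteq> {}"
    by (simp_all add: polytope_C interior_C corner_index_mem)
  show "norm (?n p) = 1" for p by (cases p) (simp add: norm_N norm_inner_normal)
  show "D s \<subseteq> {x. ?h p \<le> ?n p \<bullet> x}" for p
    using D_outer_halfspace D_inner_halfspace by (cases p) simp
  show "{F. F facet_of D s} = range (\<lambda>p. D s \<inter> {x. ?n p \<bullet> x = ?h p})"
  proof (intro equalityI subsetI)
    fix F assume "F \<in> {F. F facet_of D s}"
    then obtain i t where F: "F = S s i t" by (auto simp: facet_D)
    show "F \<in> range (\<lambda>p. D s \<inter> {x. ?n p \<bullet> x = ?h p})"
    proof (cases "t = s i")
      case True
      then obtain j where "F = D s \<inter> {x. N j (s j) \<bullet> x = H j (s j)}"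
        using F outer_facet_ex by blast
      then show ?thesis by (intro image_eqI[of _ _ "(j, True)"]) auto
    next
      case False
      then have "t = (\<not> s i)" by blast
      then have "F = D s \<inter> {x. inner_normal a i (s i) \<bullet> x = inner_offset a b i (s i)}"
        using F inner_facet[of s i] by simp
      then show ?thesis by (intro image_eqI[of _ _ "(i, False)"]) auto
    qed
  next
    fix F assume "F \<in> range (\<lambda>p. D s \<inter> {x. ?n p \<bullet> x = ?h p})"
    then obtain p where p: "F = D s \<inter> {x. ?n p \<bullet> x = ?h p}" by blast
    obtain i w where iw: "p = (i, w)" by (cases p)
    show "F \<in> {F. F facet_of D s}"
    proof (cases w)
      case True
      then have "F = D s \<inter> {x. N i (s i) \<bullet> x = H i (s i)}" using p iw by simp
      then show ?thesis using outer_facet[of s i] by (simp add: facet_D) blast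
    next
      case False
      then have "F = S s i (\<not> s i)" using p iw inner_facet[of s i] by simp
      then show ?thesis by (simp add: facet_D) blast
    qed
  qed
qed

text \<open>Parallel planes that support the same cell from the same side and both touch it
  coincide, but an inner and an outer facet are distinct. This makes the two tangency conditions of
  a pair independent.\<close>

lemma normals_differ: "inner_normal a i t \<noteq> N i t"
proof
  assume eq: "inner_normal a i t = N i t"
  \<comment> \<open>Any corner cell with \<open>s i = t\<close> is bounded by both planes; the
    constant choice is one.\<close>
  define s where "s = (\<lambda>_ :: 3. t)"
  have [simp]: "s j = t" for j by (simp add: s_def)
  obtain j where out: "D s \<inter> {x. N i t \<bullet> x = H i t} = S s j t" using outer_facet[of s i] by auto
  have inn: "D s \<inter> {x. N i t \<bullet> x = inner_offset a b i t} = S s i (\<not> t)"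
    using inner_facet[of s i] eq by simp
  have "H i t = inner_offset a b i t"
  proof (rule antisym)
    obtain x where "x \<in> D s" "N i t \<bullet> x = inner_offset a b i t" using inn S_nonempty by blast
    then show "H i t \<le> inner_offset a b i t" using D_outer_halfspace[of s i t] by auto
    obtain x where "x \<in> D s" "N i t \<bullet> x = H i t" using out S_nonempty by blast
    then show "inner_offset a b i t \<le> H i t" using D_inner_halfspace[of s i] eq by auto
  qed
  then have "S s j t = S s i (\<not> t)" using out inn by simp
  then show False by (simp add: S_inj)
qed

lemma Out_subset_D:
  assumes "\<And>i. v \<in> Out i (s i)"
  shows "v \<in> D s"
proof -
  have "v \<in> P" using assms Out_eq by blast
  then show ?thesis
    using side[OF assms] by (auto simp: cell_def corner_index_def)
qed

section \<open>Corner cells and vertices of the big polytope\<close>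

text \<open>The preimage of a corner of the unit cell lies on all three outer facets, so the three
  facets \<open>Out j (s j)\<close> meet in a nonempty face of \<open>P\<close>. An extreme point of
  that face is a vertex of \<open>P\<close> in the cell.\<close>

lemma D_corner: "D s \<in> corner_cells P (cells P a b)"
proof -
  let ?k = "corner_index s"
  let ?Q = "\<Inter>i. unit_facet ?k i (s i)"
  have Q: "?Q face_of unit_cell ?k" using unit_facet_face by (intro face_of_Inter) auto
  have "unit_vertex ?k s \<in> ?Q" by (simp add: unit_vertex_in_facet)
  then have "\<psi> ?Q \<noteq> {}" by (intro \<psi>_nonempty[OF corner_index_mem Q]) blast
  then obtain y where y: "y \<in> \<psi> ?Q" by auto
  have "y \<in> S s i (s i)" for i
    using y \<psi>_mono[OF corner_index_mem Q corner_index_mem unit_facet_face, of s i "s i"]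
    by (auto simp: S_def)
  then have "y \<in> Out j (s j)" for j
    using outer_facet[of s j] C_subset_P by (auto simp: Out_eq)
  then have ne: "(\<Inter>j. Out j (s j)) \<noteq> {}" by auto
  have \<Phi>: "(\<Inter>j. Out j (s j)) face_of P"
    using facet_P facet_of_imp_face_of by (intro face_of_Inter) blast+
  then have "compact (\<Inter>j. Out j (s j))"
    using polytope_P by (meson face_of_polytope_polytope polytope_imp_compact)
  then obtain v where "v extreme_point_of (\<Inter>j. Out j (s j))"
    using extreme_point_exists_convex[OF _ face_of_imp_convex[OF \<Phi>] ne] by blast
  then have v: "v extreme_point_of P" "v \<in> (\<Inter>j. Out j (s j))"
    using extreme_point_of_face[OF \<Phi>] by auto
  then have "v \<in> D s" by (intro Out_subset_D) auto
  then show ?thesis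
    using v(1) corner_index_mem by (auto simp: corner_cells_def cells_def)
qed

text \<open>A vertex of \<open>P\<close> lies on at least three facets and on at most one of each
  opposite pair, hence on exactly one of each pair. This choice is \<open>s\<close>; the isomorphism
  then shows that no other cell contains the vertex.\<close>

lemma corner_cellE:
  assumes "K \<in> corner_cells P (cells P a b)"
  obtains s where "K = D s"
proof -
  obtain k v where k: "k \<in> cell_indices" "K = C k" and v: "v extreme_point_of P" "v \<in> C k"
    using assms by (auto simp: corner_cells_def cells_def)
  have "\<exists>t. v \<in> Out i t" for i
  proof (rule ccontr)
    assume none: "\<nexists>t. v \<in> Out i t"
    \<comment> \<open>From each pair the map picks the only facet that can contain
      \<open>v\<close>.\<close>
    have "{F. F facet_of P \<and> v \<in> F} \<subseteq> (\<lambda>j. Out j (v \<in> Out j True)) ` (UNIV - {i})"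
    proof
      fix F assume "F \<in> {F. F facet_of P \<and> v \<in> F}"
      then obtain j t where jt: "F = Out j t" "v \<in> Out j t" using facet_P by auto
      then have "t = (v \<in> Out j True)" using disjoint[of j] by (cases t) auto
      moreover have "j \<noteq> i" using none jt by blast
      ultimately show "F \<in> (\<lambda>j. Out j (v \<in> Out j True)) ` (UNIV - {i})" using jt(1) by auto
    qed
    then have "card {F. F facet_of P \<and> v \<in> F} \<le> card (UNIV - {i})"
      by (meson surj_card_le finite)
    also have "\<dots> = 2" by simp
    finally show False
      using extreme_point_three_facets[OF polytope_P interior_P v(1)] by simp
  qed
  then obtain s where s: "\<And>i. v \<in> Out i (s i)" by metis
  then have vD: "v \<in> D s" by (rule Out_subset_D)
  \<comment> \<open>A face through \<open>v\<close> whose image lies both in the unit cell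
    \<open>k\<close> and at a corner of \<open>[0,3]^3\<close>.\<close>
  let ?I = "(D s \<inter> C k) \<inter> (\<Inter>i. S s i (s i))"
  have "v \<in> S s i (s i)" for i
    using outer_facet_ex[of s i] s vD by (auto simp: Out_eq)
  then have "v \<in> ?I" using vD v(2) by blast
  have I: "?I face_of D s"
    by (intro face_of_Int[OF C_Int_face[OF corner_index_mem]] face_of_Inter) (auto simp: S_face)
  then have IX: "?I \<in> X" by (rule face_X[OF _ corner_index_mem])
  then have "\<phi> ?I \<noteq> {}" using \<phi>_eq_iff[OF IX empty_X] \<phi>_empty \<open>v \<in> ?I\<close> by auto
  then obtain z where z: "z \<in> \<phi> ?I" by auto
  have "\<phi> ?I \<subseteq> unit_cell k"
    using \<phi>_ord[OF IX C_X[OF k(1)]] \<phi>_cell[OF k(1)] by auto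
  moreover have "\<phi> ?I \<subseteq> unit_facet (corner_index s) i (s i)" for i
    using \<phi>_ord[OF IX S_X[of s i "s i"]] \<phi>_S by auto
  ultimately have zk: "z \<in> unit_cell k" "\<And>i. z \<in> unit_facet (corner_index s) i (s i)" using z by auto
  \<comment> \<open>The coordinate of \<open>z\<close> is 0 or 3, which with \<open>k i < 3\<close>
    leaves only the index 0 or 2.\<close>
  have "k i = corner_index s i" for i
  proof -
    have "k i < 3" using k(1) by (simp add: cell_indices_def)
    moreover have "real (k i) \<le> z $ i" "z $ i \<le> real (k i) + 1" using zk(1) by (simp_all add: mem_unit_cell)
    moreover have "z $ i = real (corner_index s i) + of_bool (s i)" using zk(2)[of i] by (simp add: unit_facet_def)
    ultimately show ?thesis by (auto simp: corner_index_def split: if_splits)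
  qed
  then have "k = corner_index s" by auto
  then show thesis using that k(2) by blast
qed

section \<open>Inspheres as points of four-dimensional space\<close>

lemma circumscribed_last_corner:
  assumes circ: "\<And>s. s \<noteq> s0 \<Longrightarrow> circumscribed (D s)"
  shows "circumscribed (D s0)"
proof -
  \<comment> \<open>Pairing \<open>(c, r)\<close> with \<open>(n, -1)\<close> gives
    \<open>n \<bullet> c - r\<close>. The spheres tangent to both planes of a pair form
    \<open>A i t\<close>, with direction space \<open>V i t\<close>.\<close>
  define V :: "3 \<Rightarrow> bool \<Rightarrow> ((real^3) \<times> real) set" where
    "V i t = {x. (inner_normal a i t, -1) \<bullet> x = 0 \<and> (N i t, -1) \<bullet> x = 0}" for i t
  define A :: "3 \<Rightarrow> bool \<Rightarrow> ((real^3) \<times> real) set" where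
    "A i t = {x. (inner_normal a i t, -1) \<bullet> x = inner_offset a b i t \<and> (N i t, -1) \<bullet> x = H i t}" for i t
  have "\<exists>c r. s \<noteq> s0 \<longrightarrow> c \<in> D s \<and> r > 0 \<and> (\<forall>i. (c, r) \<in> A i (s i))" for s
  proof (cases "s = s0")
    case False
    obtain c r where "c \<in> D s" "r > 0" and
      cr: "\<And>p. (\<lambda>(i, w). if w then N i (s i) else inner_normal a i (s i)) p \<bullet> c
        - (\<lambda>(i, w). if w then H i (s i) else inner_offset a b i (s i)) p = r"
      using facet_system.circumscribedD[OF facet_system_D circ[OF False]] by blast
    moreover have "(c, r) \<in> A i (s i)" for i
      using cr[of "(i, True)"] cr[of "(i, False)"] by (simp add: A_def)
    ultimately show ?thesis by blast
  qed simp
  then have "\<forall>s. \<exists>c r. s \<noteq> s0 \<longrightarrow> c \<in> D s \<and> r > 0 \<and> (\<forall>i. (c, r) \<in> A i (s i))" by blast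
  then obtain c r where cr: "\<And>s. s \<noteq> s0 \<Longrightarrow> c s \<in> D s \<and> r s > 0 \<and> (\<forall>i. (c s, r s) \<in> A i (s i))"
    unfolding choice_iff by blast
  \<comment> \<open>Tangency with positive radius puts \<open>c s\<close> strictly beyond the second
    plane of pair \<open>i\<close>, whereas \<open>c s'\<close> lies in a cell on the other
    side.\<close>
  have c_differ: "c s \<noteq> c s'" if "s \<noteq> s0" "s' \<noteq> s0" "s i" "\<not> s' i" for s s' i
  proof
    assume eq: "c s = c s'"
    have "inner_normal a i True \<bullet> c s - r s = inner_offset a b i True"
      using cr[OF that(1)] that(3) by (auto simp: A_def dest!: spec[of _ i])
    then have "\<not> inner_normal a i True \<bullet> c s \<le> inner_offset a b i True"
      using cr[OF that(1)] by auto
    moreover have "a i 1 \<bullet> c s' \<le> b i 1"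
      using C_side[of "c s'" "corner_index s'" 1 i] cr[OF that(2)] that(4) by (simp add: corner_index_def)
    ultimately show False by (simp add: inner_halfspace_iff eq)
  qed
  have "\<exists>x. \<forall>i. x \<in> A i (s0 i)"
  proof (rule eighth_cube_vertex[where D = V and X = "\<lambda>s. (c s, r s)"])
    show "subspace (V i t)" for i t
      unfolding V_def by (intro subspaceI) (auto simp: inner_add_right)
    \<comment> \<open>The last entries -1 allow proportionality only with factor 1, that is, for
      equal normals.\<close>
    show "dim (V i t) = 2" for i t
      unfolding V_def using normals_differ[of i t]
      by (subst dim_two_hyperplanes) (auto simp: zero_prod_def)
    show "y \<in> A i t \<longleftrightarrow> y - x \<in> V i t" if "x \<in> A i t" for i t x y
      using that by (auto simp: A_def V_def inner_diff_right)
    show "(\<Inter>i. V i (s i)) \<subseteq> {0}" for s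
    proof
      fix x assume "x \<in> (\<Inter>i. V i (s i))"
      moreover obtain v w where x: "x = (v, w)" by (cases x)
      ultimately have v: "inner_normal a i (s i) \<bullet> v = w" "N i (s i) \<bullet> v = w" for i
        by (auto simp: V_def)
      have "v = 0 \<and> w = 0"
        by (rule facet_system.no_common_direction[OF facet_system_D[of s]]) (auto simp: v)
      then show "x \<in> {0}" by (simp add: x zero_prod_def)
    qed
    show "(c s, r s) \<in> A i (s i)" if "s \<noteq> s0" for s i
      using cr[OF that] by blast
    show "(c s, r s) \<noteq> (c s', r s')" if ne: "s \<noteq> s0" "s' \<noteq> s0" "s \<noteq> s'" for s s'
    proof -
      obtain i where "s i \<noteq> s' i" using ne(3) by blast
      then show ?thesis using c_differ[OF ne(1,2), of i] c_differ[OF ne(2,1), of i] by auto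
    qed
  qed
  then obtain c r where X0: "\<And>i. (c, r) \<in> A i (s0 i)" by force
  have "inner_normal a i (s0 i) \<bullet> c - inner_offset a b i (s0 i) = r" "N i (s0 i) \<bullet> c - H i (s0 i) = r" for i
    using X0[of i] by (auto simp: A_def)
  then show ?thesis
    by (intro facet_system.circumscribedI[OF facet_system_D, of s0 c r]) auto
qed

end

section \<open>From the splitting hypotheses to the cut polytope\<close>

theorem corollary4p4:
  fixes P :: "(real^3) set"
    and a :: "3 \<Rightarrow> nat \<Rightarrow> real^3" and b :: "3 \<Rightarrow> nat \<Rightarrow> real"
    and M C\<^sub>0 :: "(real^3) set"
  assumes "cubical_polytope P"
    and "split_3x3x3 P a b"
    and "central_cell P (cells P a b) M"
    and "circumscribed M"
    and "C\<^sub>0 \<in> corner_cells P (cells P a b)"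
    and "\<And>C. C \<in> corner_cells P (cells P a b) \<Longrightarrow> C \<noteq> C\<^sub>0 \<Longrightarrow> circumscribed C"
  shows "circumscribed C\<^sub>0"
proof -
  have P: "polytope P" using assms(1) by (simp add: cubical_polytope_def)
  obtain F G where a: "\<forall>i. \<forall>j<2. a i j \<noteq> 0"
    and FG: "{S. S facet_of P} = range F \<union> range G"
    and sides: "\<forall>i. F i \<inter> G i = {} \<and>
      (\<forall>j<2. F i \<subseteq> {x. a i j \<bullet> x \<le> b i j} \<and> G i \<subseteq> {x. a i j \<bullet> x \<ge> b i j})"
    and cover: "P = \<Union>(cells P a b)" and cub: "\<forall>C\<in>cells P a b. cubical_polytope C"
    and arr: "arranged_as_unit_cells (cell P a b)"
    using assms(2) unfolding split_3x3x3_def by (elim conjE exE) (rule that)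
  define X where "X = (\<Union>k\<in>cell_indices. {F. F face_of cell P a b k})"
  define Y where "Y = (\<Union>k\<in>cell_indices. {G. G face_of unit_cell k})"
  obtain \<phi> where \<phi>: "bij_betw \<phi> X Y \<and> (\<forall>F\<in>X. \<forall>F'\<in>X. F \<subseteq> F' \<longleftrightarrow> \<phi> F \<subseteq> \<phi> F') \<and>
      (\<forall>k\<in>cell_indices. \<phi> (cell P a b k) = unit_cell k)"
    using arr unfolding arranged_as_unit_cells_def Let_def X_def[symmetric] Y_def[symmetric]
    by (elim exE) (rule that)
  define Out where "Out i t = (if t then G i else F i)" for i t
  have facet: "S facet_of P \<longleftrightarrow> (\<exists>i t. S = Out i t)" for S
  proof -
    have "S facet_of P \<longleftrightarrow> S \<in> range F \<union> range G" using FG by blast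
    then show ?thesis unfolding Out_def by (metis (full_types) UnE UnI1 UnI2 rangeE rangeI)
  qed
  have "\<exists>n h. norm n = 1 \<and> P \<subseteq> {x. h \<le> n \<bullet> x} \<and> Out i t = P \<inter> {x. n \<bullet> x = h}" for i t
  proof -
    have "Out i t facet_of P" using facet by blast
    from facet_unit_normal[OF polytope_imp_polyhedron[OF P] this] show ?thesis by metis
  qed
  then have "\<forall>i t. \<exists>n h. norm n = 1 \<and> P \<subseteq> {x. h \<le> n \<bullet> x} \<and> Out i t = P \<inter> {x. n \<bullet> x = h}"
    by blast
  then obtain N H where NH: "\<And>i t. norm (N i t) = 1 \<and> P \<subseteq> {x. H i t \<le> N i t \<bullet> x} \<and>
      Out i t = P \<inter> {x. N i t \<bullet> x = H i t}"
    unfolding choice_iff by blast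
  interpret cut_polytope P a b Out N H \<phi> X Y
  proof
    show "Out i False \<inter> Out i True = {}" for i using sides by (simp add: Out_def)
    show "if t then b i j \<le> a i j \<bullet> x else a i j \<bullet> x \<le> b i j" if "x \<in> Out i t" "j < 2" for i t j x
    proof -
      have "F i \<subseteq> {x. a i j \<bullet> x \<le> b i j}" "G i \<subseteq> {x. a i j \<bullet> x \<ge> b i j}"
        using sides that(2) by simp_all
      then show ?thesis using that(1) by (auto simp: Out_def)
    qed
    show "P \<subseteq> \<Union>(cells P a b)" using cover by simp
    show "cubical_polytope (cell P a b k)" if "k \<in> cell_indices" for k
      using cub that by (simp add: cells_def)
    show "a i j \<noteq> 0" if "j < 2" for i j using a that by simp
    show "bij_betw \<phi> X Y" using \<phi> by (rule conjunct1)
    show "F \<subseteq> F' \<longleftrightarrow> \<phi> F \<subseteq> \<phi> F'" if "F \<in> X" "F' \<in> X" for F F' using \<phi> that by simp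
    show "\<phi> (cell P a b k) = unit_cell k" if "k \<in> cell_indices" for k using \<phi> that by simp
    show "norm (N i t) = 1" for i t using NH by simp
    show "P \<subseteq> {x. H i t \<le> N i t \<bullet> x}" "Out i t = P \<inter> {x. N i t \<bullet> x = H i t}" for i t
      using NH[of i t] by simp_all
  qed (fact P facet X_def Y_def)+
  obtain s0 where s0: "C\<^sub>0 = D s0" using corner_cellE[OF assms(5)] .
  have "circumscribed (D s0)"
  proof (rule circumscribed_last_corner)
    fix s assume "s \<noteq> s0"
    \<comment> \<open>The isomorphism takes cells with different indices to different unit cells, so
      only the index \<open>s0\<close> gives \<open>C\<^sub>0\<close>.\<close>
    then have "D s \<noteq> C\<^sub>0"
      unfolding s0 using C_inj[OF corner_index_mem corner_index_mem] corner_index_inj by blast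
    then show "circumscribed (D s)" by (rule assms(6)[OF D_corner])
  qed
  then show ?thesis by (simp add: s0)
qed

end
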